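(* Let $\alpha,\beta\in\mathbb{R}\setminus\mathbb{Q}$. Then $(\mathbb{Z};+,C_\alpha)$ and $(\mathbb{Z};+,C_\beta)$ are definably equivalent if and only if $\beta=q\alpha+r$ for some $q,r\in\mathbb{Q}$.
   Context: Let $C$ be the ternary relation on $\mathbb{R}/\mathbb{Z}$ (the positively oriented circle) such that for $a,b,c\in[0,1)$, $C(a+\mathbb{Z},b+\mathbb{Z},c+\mathbb{Z})$ holds iff $a<b<c$ or $b<c<a$ or $c<a<b$. For $\alpha\in\mathbb{R}\setminus\mathbb{Q}$, $C_\alpha$ is the ternary relation (an additive cyclic order) on $\mathbb{Z}$ given by: $C_\alpha(j,k,l)$ iff $C(\alpha j+\mathbb{Z},\alpha k+\mathbb{Z},\alpha l+\mathbb{Z})$. "Definable" means first-order definable, parameters allowed. If $\mathscr{M}_1$ and $\mathscr{M}_2$ are structures with the same underlying set $M$, $\mathscr{M}_1$ is a reduct of $\mathscr{M}_2$ if every $\mathscr{M}_1$-definable set (subset of some $M^k$) is definable in $\mathscr{M}_2$. Two structures are definably equivalent if each is a reduct of the other. *)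

theory Defs
  imports Complex_Main "HOL-Library.Set_Algebras"
begin

section \<open>First-order structures and definable sets\<close>

datatype 'f fo_term =
    Var nat
  | App 'f "'f fo_term list"

datatype ('f, 'r) fo_form =
    Eq "'f fo_term" "'f fo_term"
  | Rel 'r "'f fo_term list"
  | Neg "('f, 'r) fo_form"
  | Conj "('f, 'r) fo_form" "('f, 'r) fo_form"
  | Exi nat "('f, 'r) fo_form"

text \<open>
  The underlying set of a structure is the whole type \<open>'m\<close>. The interpretations only matter
  on argument lists whose length is the declared arity, see \<open>wf_term\<close> and \<open>wf_form\<close>.
\<close>

record ('f, 'r, 'm) fo_struct =
  func_arity :: "'f \<Rightarrow> nat"
  rel_arity :: "'r \<Rightarrow> nat"
  func_interp :: "'f \<Rightarrow> 'm list \<Rightarrow> 'm"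
  rel_interp :: "'r \<Rightarrow> 'm list \<Rightarrow> bool"

fun wf_term :: "('f, 'r, 'm) fo_struct \<Rightarrow> 'f fo_term \<Rightarrow> bool" where
  "wf_term S (Var n) \<longleftrightarrow> True"
| "wf_term S (App f ts) \<longleftrightarrow> length ts = func_arity S f \<and> (\<forall>t\<in>set ts. wf_term S t)"

fun wf_form :: "('f, 'r, 'm) fo_struct \<Rightarrow> ('f, 'r) fo_form \<Rightarrow> bool" where
  "wf_form S (Eq s t) \<longleftrightarrow> wf_term S s \<and> wf_term S t"
| "wf_form S (Rel r ts) \<longleftrightarrow> length ts = rel_arity S r \<and> (\<forall>t\<in>set ts. wf_term S t)"
| "wf_form S (Neg \<phi>) \<longleftrightarrow> wf_form S \<phi>"
| "wf_form S (Conj \<phi> \<psi>) \<longleftrightarrow> wf_form S \<phi> \<and> wf_form S \<psi>"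
| "wf_form S (Exi n \<phi>) \<longleftrightarrow> wf_form S \<phi>"

fun eval_term :: "('f, 'r, 'm) fo_struct \<Rightarrow> (nat \<Rightarrow> 'm) \<Rightarrow> 'f fo_term \<Rightarrow> 'm" where
  "eval_term S e (Var n) = e n"
| "eval_term S e (App f ts) = func_interp S f (map (eval_term S e) ts)"

fun sat :: "('f, 'r, 'm) fo_struct \<Rightarrow> (nat \<Rightarrow> 'm) \<Rightarrow> ('f, 'r) fo_form \<Rightarrow> bool" where
  "sat S e (Eq s t) \<longleftrightarrow> eval_term S e s = eval_term S e t"
| "sat S e (Rel r ts) \<longleftrightarrow> rel_interp S r (map (eval_term S e) ts)"
| "sat S e (Neg \<phi>) \<longleftrightarrow> \<not> sat S e \<phi>"
| "sat S e (Conj \<phi> \<psi>) \<longleftrightarrow> sat S e \<phi> \<and> sat S e \<psi>"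
| "sat S e (Exi n \<phi>) \<longleftrightarrow> (\<exists>a. sat S (e(n := a)) \<phi>)"

text \<open>
  Elements of \<open>M\<^sup>k\<close> are lists of length \<open>k\<close>. The variables below \<open>k\<close> are the coordinates of the
  tuple; the remaining free variables of the formula, of which there are only finitely many,
  carry the parameters \<open>p\<close>.
\<close>

definition definable :: "('f, 'r, 'm) fo_struct \<Rightarrow> nat \<Rightarrow> 'm list set \<Rightarrow> bool" where
  "definable S k X \<longleftrightarrow>
     (\<exists>\<phi> p. wf_form S \<phi> \<and>
        X = {xs. length xs = k \<and> sat S (\<lambda>i. if i < k then xs ! i else p i) \<phi>})"

definition is_reduct :: "('f, 'r, 'm) fo_struct \<Rightarrow> ('g, 's, 'm) fo_struct \<Rightarrow> bool" where
  "is_reduct S\<^sub>1 S\<^sub>2 \<longleftrightarrow> (\<forall>k X. definable S\<^sub>1 k X \<longrightarrow> definable S\<^sub>2 k X)"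

definition definably_equivalent ::
    "('f, 'r, 'm) fo_struct \<Rightarrow> ('g, 's, 'm) fo_struct \<Rightarrow> bool" where
  "definably_equivalent S\<^sub>1 S\<^sub>2 \<longleftrightarrow> is_reduct S\<^sub>1 S\<^sub>2 \<and> is_reduct S\<^sub>2 S\<^sub>1"


section \<open>Cyclic orders\<close>

text \<open>Elements of \<open>\<real>/\<int>\<close> are represented as the cosets \<open>a +o \<int>\<close>.\<close>

definition circle_ord :: "real set \<Rightarrow> real set \<Rightarrow> real set \<Rightarrow> bool" where
  "circle_ord A B D \<longleftrightarrow>
     (\<exists>a\<in>{0..<1}. \<exists>b\<in>{0..<1}. \<exists>c\<in>{0..<1}.
        A = a +o \<int> \<and> B = b +o \<int> \<and> D = c +o \<int> \<and>
        (a < b \<and> b < c \<or> b < c \<and> c < a \<or> c < a \<and> a < b))"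

lemma coset_Ints_inj:
  fixes a b :: real
  assumes "a \<in> {0..<1}" "b \<in> {0..<1}" "a +o \<int> = b +o \<int>"
  shows "a = b"
proof -
  have "a \<in> a +o \<int>"
    by (force simp: elt_set_plus_def)
  with assms(3) obtain n where "a = b + of_int n"
    by (auto simp: elt_set_plus_def elim: Ints_cases)
  with assms(1,2) have "- 1 < real_of_int n" "real_of_int n < 1"
    by auto
  then have "n = 0"
    by linarith
  with \<open>a = b + of_int n\<close> show ?thesis
    by simp
qed

lemma circle_ord_coset_iff:
  fixes a b c :: real
  assumes "a \<in> {0..<1}" "b \<in> {0..<1}" "c \<in> {0..<1}"
  shows "circle_ord (a +o \<int>) (b +o \<int>) (c +o \<int>) \<longleftrightarrow>
    a < b \<and> b < c \<or> b < c \<and> c < a \<or> c < a \<and> a < b"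
proof
  assume "circle_ord (a +o \<int>) (b +o \<int>) (c +o \<int>)"
  then obtain a' b' c' where mem: "a' \<in> {0..<1}" "b' \<in> {0..<1}" "c' \<in> {0..<1}"
    and eq: "a +o \<int> = a' +o \<int>" "b +o \<int> = b' +o \<int>" "c +o \<int> = c' +o \<int>"
    and ord: "a' < b' \<and> b' < c' \<or> b' < c' \<and> c' < a' \<or> c' < a' \<and> a' < b'"
    unfolding circle_ord_def by (elim bexE conjE)
  have "a = a'" "b = b'" "c = c'"
    by (rule coset_Ints_inj; fact)+
  with ord show "a < b \<and> b < c \<or> b < c \<and> c < a \<or> c < a \<and> a < b"
    by simp
next
  assume "a < b \<and> b < c \<or> b < c \<and> c < a \<or> c < a \<and> a < b"
  then show "circle_ord (a +o \<int>) (b +o \<int>) (c +o \<int>)"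
    unfolding circle_ord_def by (intro bexI[OF _ assms(1)] bexI[OF _ assms(2)] bexI[OF _ assms(3)]) simp
qed

definition cyc_ord :: "real \<Rightarrow> int \<Rightarrow> int \<Rightarrow> int \<Rightarrow> bool" where
  "cyc_ord \<alpha> j k l \<longleftrightarrow>
     circle_ord ((\<alpha> * of_int j) +o \<int>) ((\<alpha> * of_int k) +o \<int>) ((\<alpha> * of_int l) +o \<int>)"

datatype plus_sym = Plus
datatype cyc_sym = Cyc

definition int_cyc_struct :: "real \<Rightarrow> (plus_sym, cyc_sym, int) fo_struct" where
  "int_cyc_struct \<alpha> =
     \<lparr> func_arity = (\<lambda>_. 2),
       rel_arity = (\<lambda>_. 3),
       func_interp = (\<lambda>_ xs. xs ! 0 + xs ! 1),
       rel_interp = (\<lambda>_ xs. cyc_ord \<alpha> (xs ! 0) (xs ! 1) (xs ! 2)) \<rparr>"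

end

theory Submission
  imports Defs "HOL-Analysis.Kronecker_Approximation_Theorem"
begin

text \<open>
  Write \<open>{x}\<close> for the fractional part of \<open>x\<close>. The relation \<open>C\<^sub>\<alpha>(j, k, l)\<close> says that
  \<open>0 < {\<alpha>(k - j)} < {\<alpha>(l - j)}\<close>, so up to addition \<open>C\<^sub>\<alpha>\<close> is the linear order in which
  the integers are sorted by \<open>{\<alpha>x}\<close>.

  If \<open>\<beta>\<close> is a rational affine image of \<open>\<alpha>\<close>, then \<open>n\<beta> = a\<alpha> + b\<close> for integers \<open>a, b\<close> and
  \<open>n > 0\<close>. With \<open>\<gamma> = n\<beta>\<close>, the order by \<open>{\<gamma>x}\<close> is the order by \<open>{\<alpha>(ax)}\<close>, hence is definable
  from \<open>C\<^sub>\<alpha>\<close>. Moreover \<open>n{\<beta>x} = (\<lfloor>\<gamma>x\<rfloor> mod n) + {\<gamma>x}\<close>, so the order by \<open>{\<beta>x}\<close> is lexicographic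
  in the digit \<open>\<lfloor>\<gamma>x\<rfloor> mod n\<close> and \<open>{\<gamma>x}\<close>. The digit takes finitely many values, and each level
  set is definable: write \<open>x = nw + s\<close> with \<open>0 \<le> s < n\<close>, and note that \<open>\<lfloor>u + v\<rfloor>\<close> differs from
  \<open>\<lfloor>u\<rfloor> + \<lfloor>v\<rfloor>\<close> by a carry that occurs exactly when \<open>{u + v} < {v}\<close>. Thus \<open>C\<^sub>\<beta>\<close> is definable from
  \<open>C\<^sub>\<alpha>\<close> (\<open>is_reduct_rationally_related\<close>), and the situation is symmetric.

  For the converse, the key is that \<open>(\<int>; +, C\<^sub>\<alpha>)\<close> defines few sets. Identify \<open>x\<close> with
  \<open>{\<alpha>x}\<close>, an element of the ordered group \<open>\<Lambda> = \<int> + \<int>\<alpha>\<close>. Atomic formulas become sign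
  conditions on integer linear forms with bounded coefficients. A back-and-forth argument
  (\<open>same_type_extend\<close>, which rests on the density of every coset of \<open>N\<Lambda>\<close> in \<open>\<real>\<close>) shows that
  the truth of any formula is determined by finitely many such signs together with the residues
  modulo some \<open>N\<Lambda>\<close> (\<open>sat_same_type\<close>). In one variable this forces a definable set to
  be constant on \<open>{Nx | 0 < {\<alpha>x} < \<epsilon>}\<close> for suitable \<open>N\<close> and \<open>\<epsilon>\<close>. The set
  \<open>{x. C\<^sub>\<beta>(0, x, 1)}\<close> is not of this kind if \<open>1, \<alpha>, \<beta>\<close> are linearly independent over \<open>\<rat>\<close>,
  because by Kronecker's theorem \<open>{\<beta>Nx}\<close> is then dense in the unit interval even when
  \<open>{\<alpha>x}\<close> is confined to \<open>(0, \<epsilon>)\<close>.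
\<close>

section \<open>Variables of terms and formulas\<close>

fun tvars :: "'f fo_term \<Rightarrow> nat set" where
  "tvars (Var n) = {n}"
| "tvars (App f ts) = (\<Union>t\<in>set ts. tvars t)"

text \<open>
  Bound variables are included, so that a variable outside this set is fresh in every respect.
\<close>

fun fvars :: "('f, 'r) fo_form \<Rightarrow> nat set" where
  "fvars (Eq s t) = tvars s \<union> tvars t"
| "fvars (Rel r ts) = (\<Union>t\<in>set ts. tvars t)"
| "fvars (Neg \<phi>) = fvars \<phi>"
| "fvars (Conj \<phi> \<psi>) = fvars \<phi> \<union> fvars \<psi>"
| "fvars (Exi n \<phi>) = insert n (fvars \<phi>)"

lemma finite_tvars: "finite (tvars t)"
  by (induction t) auto

lemma finite_fvars: "finite (fvars \<phi>)"
  by (induction \<phi>) (auto simp: finite_tvars)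

lemma vars_bounded: "\<exists>K. k \<le> K \<and> fvars \<phi> \<subseteq> {..<K}"
proof -
  obtain K where "fvars \<phi> \<subseteq> {..<K}"
    using finite_fvars[of \<phi>] finite_nat_iff_bounded by blast
  then show ?thesis by (intro exI[of _ "max k K"]) auto
qed

lemma eval_term_cong: "(\<And>i. i \<in> tvars t \<Longrightarrow> e i = e' i) \<Longrightarrow> eval_term S e t = eval_term S e' t"
proof (induction t)
  case (App f ts)
  then have "map (eval_term S e) ts = map (eval_term S e') ts"
    by (intro map_cong) auto
  then show ?case by (simp only: eval_term.simps)
qed auto

lemma sat_cong: "(\<And>i. i \<in> fvars \<phi> \<Longrightarrow> e i = e' i) \<Longrightarrow> sat S e \<phi> = sat S e' \<phi>"
proof (induction \<phi> arbitrary: e e')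
  case (Eq s t)
  then show ?case using eval_term_cong[of s e e' S] eval_term_cong[of t e e' S] by simp
next
  case (Rel r ts)
  then have "map (eval_term S e) ts = map (eval_term S e') ts"
    by (intro map_cong eval_term_cong) auto
  then show ?case by (simp only: sat.simps)
next
  case (Exi n \<phi>)
  have "sat S (e(n := a)) \<phi> = sat S (e'(n := a)) \<phi>" for a
    using Exi.prems by (intro Exi.IH) auto
  then show ?case by simp
next
  case (Conj \<phi> \<psi>)
  have "sat S e \<phi> = sat S e' \<phi>" "sat S e \<psi> = sat S e' \<psi>"
    using Conj.prems by (intro Conj.IH; simp)+
  then show ?case by simp
next
  case (Neg \<phi>)
  have "sat S e \<phi> = sat S e' \<phi>" using Neg.prems by (intro Neg.IH) simp
  then show ?case by simp
qed

text \<open>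
  As addition is the only function symbol, terms are integer linear forms.
\<close>

lemma term_linear:
  assumes "wf_term (int_cyc_struct \<alpha>) t" "tvars t \<subseteq> {..<K}"
  shows "\<exists>a. \<forall>e. eval_term (int_cyc_struct \<alpha>) e t = (\<Sum>i<K. a i * e i)"
  using assms
proof (induction t)
  case (Var n)
  then show ?case
    by (intro exI[of _ "\<lambda>i. if i = n then 1 else 0"]) (simp add: if_distrib if_distribR cong: if_cong)
next
  case (App f ts)
  then have "length ts = 2" by (simp add: int_cyc_struct_def)
  then obtain s t where ts: "ts = [s, t]"
    by (auto simp: numeral_2_eq_2 length_Suc_conv)
  obtain a b where "\<forall>e. eval_term (int_cyc_struct \<alpha>) e s = (\<Sum>i<K. a i * e i)"
    "\<forall>e. eval_term (int_cyc_struct \<alpha>) e t = (\<Sum>i<K. b i * e i)"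
    using App.IH[of s] App.IH[of t] App.prems unfolding ts by auto
  then show ?case unfolding ts
    by (intro exI[of _ "\<lambda>i. a i + b i"])
       (simp add: int_cyc_struct_def algebra_simps sum.distrib)
qed

section \<open>The cyclic order and fractional parts\<close>

lemma frac_cong: "x - y \<in> \<int> \<Longrightarrow> frac x = frac (y::real)"
  by (metis add.commute diff_add_cancel frac_add_int_right)

lemma cyc_ord_iff_frac:
  fixes \<alpha> :: real
  defines "f \<equiv> \<lambda>j::int. frac (\<alpha> * of_int j)"
  shows "cyc_ord \<alpha> j k l \<longleftrightarrow> f j < f k \<and> f k < f l \<or> f k < f l \<and> f l < f j \<or> f l < f j \<and> f j < f k"
proof -
  have coset: "x +o \<int> = frac x +o \<int>" for x :: real
  proof (rule set_eqI)
    fix y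
    have "y \<in> x +o \<int> \<longleftrightarrow> y - x \<in> \<int>" for x :: real
      unfolding elt_set_plus_def by (auto intro!: bexI[of _ "y - x"])
    moreover have "y - frac x \<in> \<int> \<longleftrightarrow> y - x \<in> \<int>"
    proof -
      have "y - frac x = (y - x) + of_int \<lfloor>x\<rfloor>" by (simp add: frac_def)
      moreover have "z + of_int k \<in> \<int> \<longleftrightarrow> z \<in> \<int>" for z :: real and k
        using Ints_diff[of "z + of_int k" "of_int k"] by auto
      ultimately show ?thesis by (simp only:)
    qed
    ultimately show "y \<in> x +o \<int> \<longleftrightarrow> y \<in> frac x +o \<int>" by simp
  qed
  have mem: "f i \<in> {0..<1}" for i by (simp add: f_def frac_lt_1)
  show ?thesis
    unfolding cyc_ord_def coset[of "\<alpha> * of_int j"] coset[of "\<alpha> * of_int k"] coset[of "\<alpha> * of_int l"]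
    using circle_ord_coset_iff[OF mem mem mem, of j k l] unfolding f_def .
qed

text \<open>
  Rotating the circle by \<open>-\<alpha>j\<close> moves the first point to \<open>0\<close>. This form makes the translation
  invariance of the cyclic order evident and reduces it to a linear order.
\<close>

lemma cyc_ord_iff_less:
  "cyc_ord \<alpha> j k l \<longleftrightarrow>
     0 < frac (\<alpha> * of_int (k - j)) \<and> frac (\<alpha> * of_int (k - j)) < frac (\<alpha> * of_int (l - j))"
proof -
  have diff: "frac (\<alpha> * of_int (i - j)) = (if frac (\<alpha> * of_int j) \<le> frac (\<alpha> * of_int i)
      then frac (\<alpha> * of_int i) - frac (\<alpha> * of_int j) else frac (\<alpha> * of_int i) - frac (\<alpha> * of_int j) + 1)" for i
    using frac_diff_pos[of "\<alpha> * of_int j" "\<alpha> * of_int i"] frac_diff_neg[of "\<alpha> * of_int i" "\<alpha> * of_int j"]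
    by (auto simp: right_diff_distrib not_le)
  show ?thesis
    unfolding cyc_ord_iff_frac diff
    using frac_lt_1[of "\<alpha> * of_int j"] frac_lt_1[of "\<alpha> * of_int k"] frac_lt_1[of "\<alpha> * of_int l"]
      frac_ge_0[of "\<alpha> * of_int j"] frac_ge_0[of "\<alpha> * of_int k"] frac_ge_0[of "\<alpha> * of_int l"]
    by (simp del: frac_ge_0)
qed

lemma irrational_mult_int_iff:
  assumes "\<alpha> \<notin> \<rat>"
  shows "\<alpha> * of_int k \<in> \<int> \<longleftrightarrow> k = 0"
proof
  assume *: "\<alpha> * of_int k \<in> \<int>"
  show "k = 0"
  proof (rule ccontr)
    assume "k \<noteq> 0"
    then have "\<alpha> = (\<alpha> * of_int k) / of_int k" by simp
    also have "\<dots> \<in> \<rat>" using * Ints_subset_Rats by (intro Rats_divide) auto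
    finally show False using assms by simp
  qed
qed simp

lemma frac_mult_inj:
  assumes "\<alpha> \<notin> \<rat>"
  shows "frac (\<alpha> * of_int j) = frac (\<alpha> * of_int k) \<longleftrightarrow> j = k"
proof
  assume "frac (\<alpha> * of_int j) = frac (\<alpha> * of_int k)"
  then have "\<alpha> * of_int j - \<alpha> * of_int k = of_int (\<lfloor>\<alpha> * of_int j\<rfloor> - \<lfloor>\<alpha> * of_int k\<rfloor>)"
    by (simp add: frac_def)
  then have "\<alpha> * of_int (j - k) \<in> \<int>" by (metis Ints_of_int of_int_diff right_diff_distrib)
  then show "j = k" using irrational_mult_int_iff[OF assms, of "j - k"] by simp
qed simp

lemma frac_less_iff_cyc_ord:
  assumes "\<gamma> \<notin> \<rat>"
  shows "frac (\<gamma> * of_int x) < frac (\<gamma> * of_int y) \<longleftrightarrow> x = 0 \<and> y \<noteq> 0 \<or> cyc_ord \<gamma> 0 x y"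
proof -
  have "0 < frac (\<gamma> * of_int z) \<longleftrightarrow> z \<noteq> 0" for z :: int
    using irrational_mult_int_iff[OF assms, of z] by simp
  then show ?thesis by (cases "x = 0") (auto simp: cyc_ord_iff_less)
qed

lemma frac_affine: "frac ((of_int a * \<alpha> + of_int b) * of_int x) = frac (\<alpha> * of_int (a * x))" for \<alpha> :: real
proof (rule frac_cong)
  have "(of_int a * \<alpha> + of_int b) * of_int x - \<alpha> * of_int (a * x) = of_int (b * x)"
    by (simp add: algebra_simps)
  then show "(of_int a * \<alpha> + of_int b) * of_int x - \<alpha> * of_int (a * x) \<in> \<int>"
    by (metis Ints_of_int)
qed

text \<open>
  The carry in an addition can be read off from the order of fractional parts alone; this is what
  makes digits definable from the cyclic order.
\<close>

lemma floor_add_carry: "\<lfloor>x + y\<rfloor> = \<lfloor>x\<rfloor> + \<lfloor>y\<rfloor> + (if frac (x + y) < frac y then 1 else 0)" for x y :: real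
  using frac_lt_1[of x] frac_lt_1[of y] frac_ge_0[of x] frac_ge_0[of y]
  by (auto simp: floor_add frac_add simp del: frac_ge_0)

lemma floor_div_nat: "\<lfloor>of_int n * x\<rfloor> div n = \<lfloor>x\<rfloor>" if "n > 0" for x :: real and n :: int
  using floor_divide_real_eq_div[of n "of_int n * x"] that by simp

text \<open>
  Multiplying by \<open>n\<close> splits \<open>{x}\<close> into its first digit in base \<open>n\<close> and the remainder \<open>{nx}\<close>.
\<close>

lemma frac_less_iff_floor_mod:
  fixes \<beta> x y :: real
  assumes "n > 0"
  defines "i \<equiv> \<lambda>x. \<lfloor>of_int n * x\<rfloor> mod n"
  shows "frac x < frac y \<longleftrightarrow> i x < i y \<or> i x = i y \<and> frac (of_int n * x) < frac (of_int n * y)"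
proof -
  have eq: "of_int n * frac x = of_int (i x) + frac (of_int n * x)" for x
  proof -
    have "i x = \<lfloor>of_int n * x\<rfloor> - n * \<lfloor>x\<rfloor>"
      unfolding i_def minus_div_mult_eq_mod[symmetric] floor_div_nat[OF assms(1)] by simp
    then have "real_of_int (i x) = of_int \<lfloor>of_int n * x\<rfloor> - of_int n * of_int \<lfloor>x\<rfloor>" by simp
    then show ?thesis by (simp add: frac_def right_diff_distrib)
  qed
  have "frac x < frac y \<longleftrightarrow> of_int n * frac x < of_int n * frac y" using assms(1) by simp
  also have "\<dots> \<longleftrightarrow> i x < i y \<or> i x = i y \<and> frac (of_int n * x) < frac (of_int n * y)"
    unfolding eq using frac_lt_1[of "of_int n * x"] frac_lt_1[of "of_int n * y"]
      frac_ge_0[of "of_int n * x"] frac_ge_0[of "of_int n * y"]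
    by linarith
  finally show ?thesis .
qed

section \<open>Predicates expressible over a cyclic order\<close>

abbreviation tplus :: "plus_sym fo_term \<Rightarrow> plus_sym fo_term \<Rightarrow> plus_sym fo_term" where
  "tplus s t \<equiv> App Plus [s, t]"

text \<open>
  There is no symbol for subtraction, so an integer linear form is represented as a difference of
  two terms. Translation invariance of the cyclic order compensates for this in
  \<open>expressible_cyc\<close>.
\<close>

definition int_linear :: "real \<Rightarrow> ((nat \<Rightarrow> int) \<Rightarrow> int) \<Rightarrow> bool" where
  "int_linear \<alpha> f \<longleftrightarrow> (\<exists>s t. wf_term (int_cyc_struct \<alpha>) s \<and> wf_term (int_cyc_struct \<alpha>) t \<and>
     (\<forall>e. f e = eval_term (int_cyc_struct \<alpha>) e s - eval_term (int_cyc_struct \<alpha>) e t))"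

lemma int_linearI:
  "wf_term (int_cyc_struct \<alpha>) s \<Longrightarrow> wf_term (int_cyc_struct \<alpha>) t \<Longrightarrow>
   (\<And>e. f e = eval_term (int_cyc_struct \<alpha>) e s - eval_term (int_cyc_struct \<alpha>) e t) \<Longrightarrow> int_linear \<alpha> f"
  unfolding int_linear_def by blast

lemma eval_plus: "eval_term (int_cyc_struct \<alpha>) e (tplus s t) =
    eval_term (int_cyc_struct \<alpha>) e s + eval_term (int_cyc_struct \<alpha>) e t"
  by (simp add: int_cyc_struct_def)

lemma wf_plus: "wf_term (int_cyc_struct \<alpha>) (tplus s t) \<longleftrightarrow>
    wf_term (int_cyc_struct \<alpha>) s \<and> wf_term (int_cyc_struct \<alpha>) t"
  by (simp add: int_cyc_struct_def)

lemma eval_term_indep: "eval_term (int_cyc_struct \<alpha>) e t = eval_term (int_cyc_struct \<beta>) e t"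
proof (induction t)
  case (App f ts)
  then have "map (eval_term (int_cyc_struct \<alpha>) e) ts = map (eval_term (int_cyc_struct \<beta>) e) ts" by simp
  moreover have "func_interp (int_cyc_struct \<alpha>) = func_interp (int_cyc_struct \<beta>)"
    by (simp add: int_cyc_struct_def)
  ultimately show ?case by (simp only: eval_term.simps)
qed simp

lemma wf_term_indep: "wf_term (int_cyc_struct \<alpha>) t \<longleftrightarrow> wf_term (int_cyc_struct \<beta>) t"
  by (induction t) (simp_all add: int_cyc_struct_def)

lemma int_linear_term:
  assumes "wf_term (int_cyc_struct \<beta>) t"
  shows "int_linear \<alpha> (\<lambda>e. eval_term (int_cyc_struct \<beta>) e t)"
proof (rule int_linearI[of _ "tplus t t" t])
  show wf: "wf_term (int_cyc_struct \<alpha>) t" using assms wf_term_indep by blast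
  then show "wf_term (int_cyc_struct \<alpha>) (tplus t t)" unfolding wf_plus by simp
  show "eval_term (int_cyc_struct \<beta>) e t =
      eval_term (int_cyc_struct \<alpha>) e (tplus t t) - eval_term (int_cyc_struct \<alpha>) e t" for e
    unfolding eval_plus using eval_term_indep[of \<beta> e t \<alpha>] by simp
qed

lemma int_linear_var: "int_linear \<alpha> (\<lambda>e. e v)"
  using int_linear_term[of _ "Var v"] by simp

lemma int_linear_diff:
  assumes "int_linear \<alpha> f" "int_linear \<alpha> g"
  shows "int_linear \<alpha> (\<lambda>e. f e - g e)"
proof -
  obtain s t s' t' where
    "wf_term (int_cyc_struct \<alpha>) s" "wf_term (int_cyc_struct \<alpha>) t"
    "wf_term (int_cyc_struct \<alpha>) s'" "wf_term (int_cyc_struct \<alpha>) t'"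
    and f: "\<And>e. f e = eval_term (int_cyc_struct \<alpha>) e s - eval_term (int_cyc_struct \<alpha>) e t"
    and g: "\<And>e. g e = eval_term (int_cyc_struct \<alpha>) e s' - eval_term (int_cyc_struct \<alpha>) e t'"
    using assms unfolding int_linear_def by metis
  then have "wf_term (int_cyc_struct \<alpha>) (tplus s t')" "wf_term (int_cyc_struct \<alpha>) (tplus t s')"
    unfolding wf_plus by simp_all
  then show ?thesis
  proof (rule int_linearI)
    show "f e - g e = eval_term (int_cyc_struct \<alpha>) e (tplus s t') - eval_term (int_cyc_struct \<alpha>) e (tplus t s')" for e
      unfolding eval_plus f g by simp
  qed
qed

lemma int_linear_zero: "int_linear \<alpha> (\<lambda>e. 0)"
  using int_linear_diff[OF int_linear_var int_linear_var, of \<alpha> 0 0] by simp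

lemma int_linear_add:
  assumes "int_linear \<alpha> f" "int_linear \<alpha> g"
  shows "int_linear \<alpha> (\<lambda>e. f e + g e)"
  using int_linear_diff[OF assms(1) int_linear_diff[OF int_linear_zero assms(2)]] by simp

lemma int_linear_mult:
  assumes "int_linear \<alpha> f"
  shows "int_linear \<alpha> (\<lambda>e. k * f e)"
proof (induction k rule: int_induct[where k = 0])
  case base
  show ?case using int_linear_zero by simp
next
  case (step1 i)
  then show ?case using int_linear_add[OF step1(2) assms] by (simp add: algebra_simps)
next
  case (step2 i)
  then show ?case using int_linear_diff[OF step2(2) assms] by (simp add: algebra_simps)
qed

lemmas int_linear_intros = int_linear_var int_linear_zero int_linear_diff int_linear_add int_linear_mult

lemma int_linear_fresh:
  assumes "int_linear \<alpha> f"
  shows "\<exists>v. v \<noteq> u \<and> (\<forall>e x. f (e(v := x)) = f e)"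
proof -
  obtain s t where st: "\<And>e. f e = eval_term (int_cyc_struct \<alpha>) e s - eval_term (int_cyc_struct \<alpha>) e t"
    using assms unfolding int_linear_def by blast
  obtain v where v: "v \<notin> insert u (tvars s \<union> tvars t)"
    using ex_new_if_finite[of "insert u (tvars s \<union> tvars t)"] finite_tvars by auto
  have "eval_term (int_cyc_struct \<alpha>) (e(v := x)) s = eval_term (int_cyc_struct \<alpha>) e s"
    "eval_term (int_cyc_struct \<alpha>) (e(v := x)) t = eval_term (int_cyc_struct \<alpha>) e t" for e x
    using v by (auto intro!: eval_term_cong)
  then have "f (e(v := x)) = f e" for e x unfolding st by simp
  moreover have "v \<noteq> u" using v by simp
  ultimately show ?thesis by blast
qed

text \<open>
  The variable \<open>u\<close> is reserved for the integer \<open>1\<close>, which no closed term denotes; in the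
  end it is supplied as a parameter. Working with predicates on assignments instead of formulas
  lets closure properties replace explicit syntax.
\<close>

definition expressible :: "real \<Rightarrow> nat \<Rightarrow> ((nat \<Rightarrow> int) \<Rightarrow> bool) \<Rightarrow> bool" where
  "expressible \<alpha> u P \<longleftrightarrow>
     (\<exists>\<phi>. wf_form (int_cyc_struct \<alpha>) \<phi> \<and> (\<forall>e. e u = 1 \<longrightarrow> sat (int_cyc_struct \<alpha>) e \<phi> = P e))"

lemma expressible_cong:
  "expressible \<alpha> u P \<Longrightarrow> (\<And>e. e u = 1 \<Longrightarrow> P e = Q e) \<Longrightarrow> expressible \<alpha> u Q"
  unfolding expressible_def by metis

lemma expressible_not: "expressible \<alpha> u P \<Longrightarrow> expressible \<alpha> u (\<lambda>e. \<not> P e)"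
  unfolding expressible_def by (metis sat.simps(3) wf_form.simps(3))

lemma expressible_and:
  "expressible \<alpha> u P \<Longrightarrow> expressible \<alpha> u Q \<Longrightarrow> expressible \<alpha> u (\<lambda>e. P e \<and> Q e)"
  unfolding expressible_def by (metis sat.simps(4) wf_form.simps(4))

lemma expressible_or:
  "expressible \<alpha> u P \<Longrightarrow> expressible \<alpha> u Q \<Longrightarrow> expressible \<alpha> u (\<lambda>e. P e \<or> Q e)"
  using expressible_not[OF expressible_and[OF expressible_not expressible_not], of \<alpha> u P Q] by simp

lemma expressible_ex:
  assumes "expressible \<alpha> u P" "v \<noteq> u"
  shows "expressible \<alpha> u (\<lambda>e. \<exists>x. P (e(v := x)))"
proof -
  obtain \<phi> where "wf_form (int_cyc_struct \<alpha>) \<phi>" "\<And>e. e u = 1 \<Longrightarrow> sat (int_cyc_struct \<alpha>) e \<phi> = P e"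
    using assms(1) unfolding expressible_def by blast
  with assms(2) show ?thesis unfolding expressible_def
    by (intro exI[of _ "Exi v \<phi>"]) simp
qed

lemma expressible_eq:
  assumes "int_linear \<alpha> f" "int_linear \<alpha> g"
  shows "expressible \<alpha> u (\<lambda>e. f e = g e)"
proof -
  have "int_linear \<alpha> (\<lambda>e. f e - g e)" using assms by (rule int_linear_diff)
  then obtain s t where st: "wf_term (int_cyc_struct \<alpha>) s" "wf_term (int_cyc_struct \<alpha>) t"
    "\<And>e. f e - g e = eval_term (int_cyc_struct \<alpha>) e s - eval_term (int_cyc_struct \<alpha>) e t"
    unfolding int_linear_def by blast
  have "f e = g e \<longleftrightarrow> sat (int_cyc_struct \<alpha>) e (Eq s t)" for e using st(3)[of e] by auto
  then show ?thesis unfolding expressible_def using st(1,2)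
    by (intro exI[of _ "Eq s t"]) simp
qed

lemma expressible_const: "expressible \<alpha> u (\<lambda>e. b)"
proof (cases b)
  case True then show ?thesis using expressible_eq[OF int_linear_zero int_linear_zero] by simp
next
  case False then show ?thesis using expressible_not[OF expressible_eq[OF int_linear_zero int_linear_zero]] by simp
qed

lemma expressible_disj:
  "finite A \<Longrightarrow> (\<And>a. a \<in> A \<Longrightarrow> expressible \<alpha> u (P a)) \<Longrightarrow> expressible \<alpha> u (\<lambda>e. \<exists>a\<in>A. P a e)"
  by (induction A rule: finite_induct) (auto simp: expressible_const intro: expressible_or)

text \<open>
  Adding the same integer to all three arguments does not change the cyclic order, so adding the
  sum of the three subtrahends turns differences of terms into terms.
\<close>

lemma expressible_cyc:
  assumes "int_linear \<alpha> f" "int_linear \<alpha> g" "int_linear \<alpha> h"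
  shows "expressible \<alpha> u (\<lambda>e. cyc_ord \<alpha> (f e) (g e) (h e))"
proof -
  let ?S = "int_cyc_struct \<alpha>"
  obtain s1 t1 s2 t2 s3 t3 where wf: "wf_term ?S s1" "wf_term ?S t1" "wf_term ?S s2" "wf_term ?S t2" "wf_term ?S s3" "wf_term ?S t3"
    and ev: "\<And>e. f e = eval_term ?S e s1 - eval_term ?S e t1" "\<And>e. g e = eval_term ?S e s2 - eval_term ?S e t2"
      "\<And>e. h e = eval_term ?S e s3 - eval_term ?S e t3"
    using assms unfolding int_linear_def by metis
  have shift: "cyc_ord \<alpha> j k l = cyc_ord \<alpha> (j + m) (k + m) (l + m)" for j k l m
    unfolding cyc_ord_iff_less by simp
  let ?\<phi> = "Rel Cyc [tplus s1 (tplus t2 t3), tplus s2 (tplus t1 t3), tplus s3 (tplus t1 t2)]"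
  have "wf_form ?S ?\<phi>" using wf by (simp add: int_cyc_struct_def)
  moreover have "sat ?S e ?\<phi> = cyc_ord \<alpha> (f e) (g e) (h e)" for e
  proof -
    define T where "T = eval_term ?S e t1 + eval_term ?S e t2 + eval_term ?S e t3"
    have "sat ?S e ?\<phi> = cyc_ord \<alpha> (eval_term ?S e (tplus s1 (tplus t2 t3)))
        (eval_term ?S e (tplus s2 (tplus t1 t3))) (eval_term ?S e (tplus s3 (tplus t1 t2)))"
      by (simp add: int_cyc_struct_def)
    also have "\<dots> = cyc_ord \<alpha> (f e + T) (g e + T) (h e + T)"
      unfolding eval_plus ev T_def by (simp add: algebra_simps)
    also have "\<dots> = cyc_ord \<alpha> (f e) (g e) (h e)" using shift by simp
    finally show ?thesis .
  qed
  ultimately show ?thesis unfolding expressible_def by blast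
qed

lemma expressible_frac_less:
  assumes "int_linear \<alpha> f" "int_linear \<alpha> g" "\<gamma> \<notin> \<rat>" "\<gamma> = of_int a * \<alpha> + of_int b"
  shows "expressible \<alpha> u (\<lambda>e. frac (\<gamma> * of_int (f e)) < frac (\<gamma> * of_int (g e)))"
proof -
  have "cyc_ord \<gamma> 0 x y \<longleftrightarrow> cyc_ord \<alpha> 0 (a * x) (a * y)" for x y
    unfolding cyc_ord_iff_less assms(4) frac_affine by simp
  then show ?thesis
    unfolding frac_less_iff_cyc_ord[OF assms(3)]
    by (simp only:) (intro expressible_or expressible_and expressible_not expressible_eq expressible_cyc int_linear_intros assms)
qed

section \<open>Expressing the cyclic order of a rational affine image\<close>

text \<open>
  With \<open>y = \<gamma>f\<close>, the difference \<open>\<lfloor>ky\<rfloor> - k\<lfloor>y\<rfloor> = \<lfloor>k{y}\<rfloor>\<close> counts the carries that occur while the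
  multiples \<open>y, 2y, \<dots>, ky\<close> are formed by successive addition.
\<close>

lemma expressible_floor_multiple:
  fixes \<gamma> :: real
  assumes "int_linear \<alpha> f" "\<gamma> \<notin> \<rat>" "\<gamma> = of_int a * \<alpha> + of_int b"
  shows "expressible \<alpha> u (\<lambda>e. \<lfloor>of_nat k * (\<gamma> * of_int (f e))\<rfloor> - int k * \<lfloor>\<gamma> * of_int (f e)\<rfloor> = c)"
proof (induction k arbitrary: c)
  case 0
  show ?case by (simp add: expressible_const)
next
  case (Suc k)
  define y where "y e = \<gamma> * of_int (f e)" for e
  define D where "D e = \<lfloor>of_nat k * y e\<rfloor> - int k * \<lfloor>y e\<rfloor>" for e
  define wrap where "wrap e \<longleftrightarrow> frac (\<gamma> * of_int (int (Suc k) * f e)) < frac (\<gamma> * of_int (f e))" for e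
  have IH: "expressible \<alpha> u (\<lambda>e. D e = d)" for d using Suc.IH by (simp only: D_def y_def)
  have wrap: "expressible \<alpha> u wrap"
    unfolding wrap_def by (intro expressible_frac_less[OF _ _ assms(2,3)] int_linear_intros assms(1))
  have step: "\<lfloor>of_nat (Suc k) * y e\<rfloor> - int (Suc k) * \<lfloor>y e\<rfloor> = D e + (if wrap e then 1 else 0)" for e
  proof -
    have "of_nat (Suc k) * y e = of_nat k * y e + y e" by (simp add: algebra_simps)
    moreover have "frac (of_nat (Suc k) * y e) = frac (\<gamma> * of_int (int (Suc k) * f e))" by (simp add: y_def mult_ac)
    moreover have "frac (\<gamma> * of_int (f e)) = frac (y e)" by (simp add: y_def)
    ultimately have "\<lfloor>of_nat (Suc k) * y e\<rfloor> = \<lfloor>of_nat k * y e\<rfloor> + \<lfloor>y e\<rfloor> + (if wrap e then 1 else 0)"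
      using floor_add_carry[of "of_nat k * y e" "y e"] by (simp only: wrap_def)
    then show ?thesis by (simp add: D_def algebra_simps)
  qed
  have "expressible \<alpha> u (\<lambda>e. wrap e \<and> D e = c - 1 \<or> \<not> wrap e \<and> D e = c)"
    by (intro expressible_or expressible_and expressible_not IH wrap)
  then show ?case
    by (rule expressible_cong) (unfold y_def[symmetric] step, auto)
qed

text \<open>
  Division with remainder \<open>f = nw + s\<close> reduces the digit of \<open>f\<close> to that of \<open>nw\<close>, which is a count
  of carries, to the digit of the constant \<open>s\<close>, and to one more carry. There are only finitely many
  possible values for each of the ingredients.
\<close>

lemma expressible_floor_mod:
  fixes \<gamma> :: real and n :: nat
  assumes "int_linear \<alpha> f" "\<gamma> \<notin> \<rat>" "\<gamma> = of_int a * \<alpha> + of_int b" "n > 0"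
  shows "expressible \<alpha> u (\<lambda>e. \<lfloor>\<gamma> * of_int (f e)\<rfloor> mod int n = c)"
proof -
  obtain v where v: "v \<noteq> u" "\<And>e x. f (e(v := x)) = f e" using int_linear_fresh[OF assms(1)] by blast
  define D where "D w = \<lfloor>of_nat n * (\<gamma> * of_int w)\<rfloor> - int n * \<lfloor>\<gamma> * of_int w\<rfloor>" for w :: int
  define carry where "carry s x \<longleftrightarrow> frac (\<gamma> * of_int x) < frac (\<gamma> * of_int s)" for s x :: int
  have floor_eq: "\<lfloor>\<gamma> * of_int (int n * w + s)\<rfloor> mod int n =
      (D w + \<lfloor>\<gamma> * of_int s\<rfloor> + (if carry s (int n * w + s) then 1 else 0)) mod int n" for w s
  proof -
    have "\<gamma> * of_int (int n * w + s) = of_nat n * (\<gamma> * of_int w) + \<gamma> * of_int s"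
      by (simp add: algebra_simps)
    then have "\<lfloor>\<gamma> * of_int (int n * w + s)\<rfloor> =
      D w + \<lfloor>\<gamma> * of_int s\<rfloor> + (if carry s (int n * w + s) then 1 else 0) + int n * \<lfloor>\<gamma> * of_int w\<rfloor>"
      using floor_add_carry[of "of_nat n * (\<gamma> * of_int w)" "\<gamma> * of_int s"]
      by (simp only: D_def carry_def)
    then show ?thesis by simp
  qed
  \<comment> \<open>Bounded by \<open>n\<close>, so the disjunction over the values of \<open>D w\<close> is finite.\<close>
  have D_range: "D w \<in> {0..int n}" for w
  proof -
    have "D w = \<lfloor>of_nat n * frac (\<gamma> * of_int w)\<rfloor>"
    proof -
      have "of_nat n * frac (\<gamma> * of_int w) = of_nat n * (\<gamma> * of_int w) - of_int (int n * \<lfloor>\<gamma> * of_int w\<rfloor>)"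
        by (simp add: frac_def algebra_simps)
      then show ?thesis by (simp only: D_def floor_diff_of_int)
    qed
    moreover have "0 \<le> of_nat n * frac (\<gamma> * of_int w)" "of_nat n * frac (\<gamma> * of_int w) \<le> of_nat n"
      by (auto intro: mult_left_le less_imp_le[OF frac_lt_1])
    ultimately show ?thesis by (simp add: floor_le_iff)
  qed
  have carry: "expressible \<alpha> u (\<lambda>e. carry s (f e))" for s
  proof (rule expressible_cong)
    show "expressible \<alpha> u (\<lambda>e. frac (\<gamma> * of_int (f e)) < frac (\<gamma> * of_int (s * e u)))"
      by (intro expressible_frac_less[OF _ _ assms(2,3)] int_linear_intros assms(1))
  qed (simp add: carry_def)
  have D: "expressible \<alpha> u (\<lambda>e. D (e v) = d)" for d
    unfolding D_def by (rule expressible_floor_multiple[OF int_linear_var assms(2,3)])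
  define Q where "Q e \<longleftrightarrow> (\<exists>s\<in>{0..<int n}. f e = int n * e v + s * e u \<and> (\<exists>d\<in>{0..int n}. D (e v) = d \<and>
        (carry s (f e) \<and> (d + \<lfloor>\<gamma> * of_int s\<rfloor> + 1) mod int n = c \<or>
         \<not> carry s (f e) \<and> (d + \<lfloor>\<gamma> * of_int s\<rfloor>) mod int n = c)))" for e
  have "expressible \<alpha> u Q" unfolding Q_def
    by (intro expressible_disj expressible_and expressible_or expressible_not expressible_const
        expressible_eq int_linear_intros assms(1) carry D finite_atLeastAtMost_int finite_atLeastLessThan_int)
  then have "expressible \<alpha> u (\<lambda>e. \<exists>x. Q (e(v := x)))" by (rule expressible_ex[OF _ v(1)])
  then show ?thesis
  proof (rule expressible_cong)
    fix e :: "nat \<Rightarrow> int" assume e: "e u = 1"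
    let ?i = "\<lambda>x. \<lfloor>\<gamma> * of_int x\<rfloor> mod int n"
    have Q: "Q (e(v := x)) \<longleftrightarrow> (\<exists>s\<in>{0..<int n}. f e = int n * x + s \<and> ?i (int n * x + s) = c)" for x
      unfolding Q_def floor_eq using v D_range[of x] e by (intro bex_cong) auto
    show "(\<exists>x. Q (e(v := x))) \<longleftrightarrow> ?i (f e) = c"
    proof
      assume i: "?i (f e) = c"
      have fe: "f e = int n * (f e div int n) + f e mod int n" by simp
      have "f e mod int n \<in> {0..<int n}" using assms(4) by simp
      then have "Q (e(v := f e div int n))"
        unfolding Q by (rule bexI[rotated]) (use fe i in simp)
      then show "\<exists>x. Q (e(v := x))" by blast
    qed (auto simp: Q)
  qed
qed

lemma expressible_frac_less_divide:
  fixes \<beta> :: real and n :: nat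
  assumes "int_linear \<alpha> f" "int_linear \<alpha> g" "\<beta> \<notin> \<rat>" "n > 0" "of_nat n * \<beta> = of_int a * \<alpha> + of_int b"
  shows "expressible \<alpha> u (\<lambda>e. frac (\<beta> * of_int (f e)) < frac (\<beta> * of_int (g e)))"
proof -
  define \<gamma> where "\<gamma> = of_nat n * \<beta>"
  have \<gamma>: "\<gamma> \<notin> \<rat>" "\<gamma> = of_int a * \<alpha> + of_int b"
  proof -
    show "\<gamma> \<notin> \<rat>"
    proof
      assume "\<gamma> \<in> \<rat>"
      then have "\<gamma> / of_nat n \<in> \<rat>" by (intro Rats_divide) auto
      with assms(3,4) show False by (simp add: \<gamma>_def)
    qed
  qed (simp add: \<gamma>_def assms(5))
  define i where "i x = \<lfloor>\<gamma> * of_int x\<rfloor> mod int n" for x :: int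
  have range: "i x \<in> {0..<int n}" for x using assms(4) by (simp add: i_def)
  have i: "expressible \<alpha> u (\<lambda>e. i (h e) = c)" if "int_linear \<alpha> h" for h c
    unfolding i_def by (rule expressible_floor_mod[OF that \<gamma> assms(4)])
  have "frac (\<beta> * of_int x) < frac (\<beta> * of_int y) \<longleftrightarrow>
      i x < i y \<or> i x = i y \<and> frac (\<gamma> * of_int x) < frac (\<gamma> * of_int y)" for x y :: int
    using frac_less_iff_floor_mod[of "int n" "\<beta> * of_int x" "\<beta> * of_int y"] assms(4)
    by (simp add: i_def \<gamma>_def mult.assoc)
  then have eq: "frac (\<beta> * of_int x) < frac (\<beta> * of_int y) \<longleftrightarrow>
      (\<exists>c\<in>{0..<int n}. \<exists>d\<in>{0..<int n}. i x = c \<and> i y = d \<and>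
        (c < d \<or> c = d \<and> frac (\<gamma> * of_int x) < frac (\<gamma> * of_int y)))" for x y :: int
    using range by blast
  show ?thesis unfolding eq
    by (intro expressible_disj expressible_and expressible_or expressible_const i assms(1,2)
        expressible_frac_less[OF _ _ \<gamma>] finite_atLeastLessThan_int)
qed

lemma expressible_cyc_divide:
  fixes \<beta> :: real and n :: nat
  assumes "int_linear \<alpha> f" "int_linear \<alpha> g" "int_linear \<alpha> h" "\<beta> \<notin> \<rat>" "n > 0" "of_nat n * \<beta> = of_int a * \<alpha> + of_int b"
  shows "expressible \<alpha> u (\<lambda>e. cyc_ord \<beta> (f e) (g e) (h e))"
proof -
  have eq: "cyc_ord \<beta> j k l \<longleftrightarrow> frac (\<beta> * of_int 0) < frac (\<beta> * of_int (k - j)) \<and>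
      frac (\<beta> * of_int (k - j)) < frac (\<beta> * of_int (l - j))" for j k l
    unfolding cyc_ord_iff_less by simp
  show ?thesis unfolding eq
    by (intro expressible_and expressible_frac_less_divide[OF _ _ assms(4-6)] int_linear_intros assms(1-3))
qed

lemma expressible_sat:
  fixes \<beta> :: real and n :: nat
  assumes \<beta>: "\<beta> \<notin> \<rat>" "n > 0" "of_nat n * \<beta> = of_int a * \<alpha> + of_int b"
  shows "wf_form (int_cyc_struct \<beta>) \<phi> \<Longrightarrow> u \<notin> fvars \<phi> \<Longrightarrow>
    expressible \<alpha> u (\<lambda>e. sat (int_cyc_struct \<beta>) e \<phi>)"
proof (induction \<phi>)
  case (Eq s t)
  then show ?case by (simp add: expressible_eq int_linear_term)
next
  case (Rel r ts)
  then have "length ts = 3" by (simp add: int_cyc_struct_def)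
  then obtain t1 t2 t3 where ts: "ts = [t1, t2, t3]"
    by (auto simp: numeral_3_eq_3 length_Suc_conv)
  have "sat (int_cyc_struct \<beta>) e (Rel r ts) = cyc_ord \<beta> (eval_term (int_cyc_struct \<beta>) e t1)
      (eval_term (int_cyc_struct \<beta>) e t2) (eval_term (int_cyc_struct \<beta>) e t3)" for e
    by (simp add: ts int_cyc_struct_def)
  then show ?case using Rel ts by (simp only:) (intro expressible_cyc_divide[OF _ _ _ \<beta>] int_linear_term; simp)
next
  case (Neg \<phi>)
  then show ?case by (simp add: expressible_not)
next
  case (Conj \<phi> \<psi>)
  then show ?case by (simp add: expressible_and)
next
  case (Exi v \<phi>)
  then have "v \<noteq> u" "expressible \<alpha> u (\<lambda>e. sat (int_cyc_struct \<beta>) e \<phi>)" by auto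
  then show ?case unfolding sat.simps by (intro expressible_ex)
qed

lemma is_reduct_rationally_related:
  fixes \<alpha> \<beta> :: real and n :: nat
  assumes "\<beta> \<notin> \<rat>" "n > 0" "of_nat n * \<beta> = of_int a * \<alpha> + of_int b"
  shows "is_reduct (int_cyc_struct \<beta>) (int_cyc_struct \<alpha>)"
  unfolding is_reduct_def
proof (intro allI impI)
  fix k X assume "definable (int_cyc_struct \<beta>) k X"
  then obtain \<phi> p where \<phi>: "wf_form (int_cyc_struct \<beta>) \<phi>"
    and X: "X = {xs. length xs = k \<and> sat (int_cyc_struct \<beta>) (\<lambda>i. if i < k then xs ! i else p i) \<phi>}"
    unfolding definable_def by blast
  obtain u where u: "k \<le> u" "fvars \<phi> \<subseteq> {..<u}" using vars_bounded by blast
  then have "u \<notin> fvars \<phi>" by auto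
  then obtain \<psi> where \<psi>: "wf_form (int_cyc_struct \<alpha>) \<psi>"
    and \<psi>_iff: "\<And>e. e u = 1 \<Longrightarrow> sat (int_cyc_struct \<alpha>) e \<psi> = sat (int_cyc_struct \<beta>) e \<phi>"
    using expressible_sat[OF assms \<phi>] unfolding expressible_def by blast
  have "sat (int_cyc_struct \<alpha>) (\<lambda>i. if i < k then xs ! i else (p(u := 1)) i) \<psi> =
      sat (int_cyc_struct \<beta>) (\<lambda>i. if i < k then xs ! i else p i) \<phi>" for xs
  proof -
    have "sat (int_cyc_struct \<alpha>) (\<lambda>i. if i < k then xs ! i else (p(u := 1)) i) \<psi> =
        sat (int_cyc_struct \<beta>) (\<lambda>i. if i < k then xs ! i else (p(u := 1)) i) \<phi>"
      using u by (intro \<psi>_iff) simp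
    also have "\<dots> = sat (int_cyc_struct \<beta>) (\<lambda>i. if i < k then xs ! i else p i) \<phi>"
      by (rule sat_cong) (use \<open>u \<notin> fvars \<phi>\<close> in auto)
    finally show ?thesis .
  qed
  then show "definable (int_cyc_struct \<alpha>) k X"
    unfolding definable_def X using \<psi> by (intro exI[of _ \<psi>] exI[of _ "p(u := 1)"]) simp
qed

lemma rational_affine_clear_denominators:
  fixes \<alpha> \<beta> :: real
  assumes "\<beta> = q * \<alpha> + r" "q \<in> \<rat>" "r \<in> \<rat>"
  shows "\<exists>n>0. \<exists>a b. of_nat n * \<beta> = of_int a * \<alpha> + of_int b"
proof -
  obtain a m where q: "q = of_int a / of_int m" "m > 0" using assms(2) by (rule Rats_cases')
  obtain b l where r: "r = of_int b / of_int l" "l > 0" using assms(3) by (rule Rats_cases')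
  have "of_nat (nat (m * l)) * \<beta> = of_int (a * l) * \<alpha> + of_int (b * m)"
    using q r assms(1) by (simp add: field_simps)
  moreover have "nat (m * l) > 0" using q r by simp
  ultimately show ?thesis by blast
qed

section \<open>Back-and-forth in the ordered group generated by 1 and an irrational\<close>

text \<open>
  This is the subgroup \<open>N\<Lambda>\<close> of the group \<open>\<Lambda> = \<int> + \<int>\<alpha>\<close>.
\<close>

definition grid :: "real \<Rightarrow> int \<Rightarrow> real set" where
  "grid \<alpha> N = {of_int N * (of_int s + of_int t * \<alpha>) | s t. True}"

lemma gridI: "of_int N * (of_int s + of_int t * \<alpha>) \<in> grid \<alpha> N"
  unfolding grid_def by blast

lemma grid_0: "0 \<in> grid \<alpha> N"
  using gridI[of N 0 0 \<alpha>] by simp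

lemma grid_add: "x \<in> grid \<alpha> N \<Longrightarrow> y \<in> grid \<alpha> N \<Longrightarrow> x + y \<in> grid \<alpha> N"
  unfolding grid_def
proof clarsimp
  fix s t s' t' :: int
  show "\<exists>sa ta. real_of_int N * (real_of_int s + real_of_int t * \<alpha>) + real_of_int N * (real_of_int s' + real_of_int t' * \<alpha>) =
          real_of_int N * (real_of_int sa + real_of_int ta * \<alpha>)"
    by (rule exI[of _ "s+s'"], rule exI[of _ "t+t'"]) (simp add: algebra_simps)
qed

lemma grid_mult: "x \<in> grid \<alpha> N \<Longrightarrow> of_int k * x \<in> grid \<alpha> (k * N)"
  unfolding grid_def by (auto simp: mult.assoc)

lemma grid_mono: "N dvd M \<Longrightarrow> grid \<alpha> M \<subseteq> grid \<alpha> N"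
proof
  fix x assume "N dvd M" and "x \<in> grid \<alpha> M"
  then obtain j s t where "M = N * j" and "x = of_int M * (of_int s + of_int t * \<alpha>)"
    unfolding grid_def by (blast elim: dvdE)
  then have "x = of_int N * (of_int (j * s) + of_int (j * t) * \<alpha>)"
    by (simp add: algebra_simps)
  then show "x \<in> grid \<alpha> N" using gridI by metis
qed

lemma grid_scale: "x \<in> grid \<alpha> N \<Longrightarrow> of_int k * x \<in> grid \<alpha> N"
  using grid_mult[of x \<alpha> N k] grid_mono[of N "k * N" \<alpha>] by auto

lemma grid_sum: "(\<And>i. i \<in> I \<Longrightarrow> f i \<in> grid \<alpha> N) \<Longrightarrow> sum f I \<in> grid \<alpha> N"
  by (induction I rule: infinite_finite_induct) (auto simp: grid_0 intro: grid_add)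

lemma grid_dense:
  assumes "\<alpha> \<notin> \<rat>" and "N > 0" and "l < h"
  shows "\<exists>g\<in>grid \<alpha> N. l < c + g \<and> c + g < h"
proof -
  define m where "m = ((l + h) / 2 - c) / of_int N"
  define \<epsilon> where "\<epsilon> = (h - l) / 2 / of_int N"
  have "\<epsilon> > 0" using assms by (simp add: \<epsilon>_def)
  then obtain p k where "k > 0" and pk: "\<bar>of_int k * \<alpha> - of_int p - m\<bar> < \<epsilon>"
    using sequence_of_fractional_parts_is_dense[OF assms(1), of \<epsilon> m] by blast
  let ?g = "of_int N * (of_int (- p) + of_int k * \<alpha>)"
  have "\<bar>of_int N * (of_int k * \<alpha> - of_int p - m)\<bar> < of_int N * \<epsilon>"
    using pk \<open>N > 0\<close> by (simp add: abs_mult)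
  moreover have "of_int N * \<epsilon> = (h - l) / 2" "of_int N * m = (l + h) / 2 - c"
    using \<open>N > 0\<close> by (simp_all add: \<epsilon>_def m_def)
  moreover have "of_int N * (of_int k * \<alpha> - of_int p - m) = ?g - of_int N * m"
    by (simp add: algebra_simps)
  ultimately have "\<bar>?g - ((l + h) / 2 - c)\<bar> < (h - l) / 2" by metis
  then have "l < c + ?g \<and> c + ?g < h" by (simp only: abs_less_iff) argo
  then show ?thesis using gridI by blast
qed

text \<open>
  A finite approximation to equality of types over the ordered group \<open>\<Lambda>\<close>: \<open>N\<close> bounds the
  coefficients of the linear inequalities that are tested and is also the modulus of the
  congruences. A single parameter suffices because the relation becomes coarser when \<open>N\<close> is
  replaced by a divisor.
\<close>

definition same_type :: "'i set \<Rightarrow> real \<Rightarrow> int \<Rightarrow> ('i \<Rightarrow> real) \<Rightarrow> ('i \<Rightarrow> real) \<Rightarrow> bool" where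
  "same_type I \<alpha> N u v \<longleftrightarrow>
     (\<forall>a. (\<forall>i\<in>I. \<bar>a i\<bar> \<le> N) \<longrightarrow>
        sgn (\<Sum>i\<in>I. of_int (a i) * u i) = sgn (\<Sum>i\<in>I. of_int (a i) * v i)) \<and>
     (\<forall>i\<in>I. v i - u i \<in> grid \<alpha> N)"

lemma same_type_mono:
  assumes "same_type I \<alpha> M u v" "N dvd M" "M > 0"
  shows "same_type I \<alpha> N u v"
proof -
  have "N \<le> M" using assms zdvd_imp_le by blast
  then show ?thesis using assms grid_mono[OF assms(2), of \<alpha>] unfolding same_type_def
    by (meson order_trans subsetD)
qed

lemma same_type_sym: "same_type I \<alpha> N u v \<Longrightarrow> same_type I \<alpha> N v u"
proof -
  have "v i - u i \<in> grid \<alpha> N \<Longrightarrow> u i - v i \<in> grid \<alpha> N" for i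
    using grid_scale[of "v i - u i" \<alpha> N "-1"] by simp
  then show "same_type I \<alpha> N u v \<Longrightarrow> same_type I \<alpha> N v u" unfolding same_type_def by metis
qed

lemma same_type_sgn:
  "same_type I \<alpha> N u v \<Longrightarrow> (\<And>i. i \<in> I \<Longrightarrow> \<bar>a i\<bar> \<le> N) \<Longrightarrow>
   sgn (\<Sum>i\<in>I. of_int (a i) * u i) = sgn (\<Sum>i\<in>I. of_int (a i) * v i)"
  unfolding same_type_def by blast

lemma finite_sets_separated:
  fixes A B :: "real set"
  assumes "finite A" "finite B" "\<And>a b. a \<in> A \<Longrightarrow> b \<in> B \<Longrightarrow> a < b"
  shows "\<exists>l h. l < h \<and> (\<forall>a\<in>A. a \<le> l) \<and> (\<forall>b\<in>B. h \<le> b)"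
proof (cases "A = {}")
  case True
  define m where "m = Min (insert 0 B)"
  have "\<forall>b\<in>B. m \<le> b" using assms(2) by (simp add: m_def)
  then show ?thesis
    by (intro exI[of _ "m - 1"] exI[of _ m] conjI) (simp_all add: True)
next
  case False
  define m where "m = Max A"
  have m: "m \<in> A" "\<forall>a\<in>A. a \<le> m" using False assms(1) by (simp_all add: m_def)
  define h where "h = Min (insert (m + 1) B)"
  have "m < h" "\<forall>b\<in>B. h \<le> b" using assms m(1) by (simp_all add: h_def)
  with m show ?thesis by blast
qed

text \<open>
  The extension step of the back-and-forth argument. The value \<open>c\<close> is located among the roots
  \<open>-A(u) / b\<close> of the finitely many forms \<open>b X + A(u)\<close> with small coefficients, where \<open>A\<close> is a form
  in the other coordinates. If \<open>c\<close> is such a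
  root, then \<open>d\<close> is the corresponding root over \<open>v\<close>; the divisibility by \<open>b\<close> that makes \<open>d\<close> congruent
  to \<open>c\<close> comes from the factor \<open>N!\<close> in the modulus. Otherwise \<open>c\<close> lies in an open
  interval between roots, the roots over \<open>v\<close> are ordered in the same way, and \<open>d\<close> is found in the
  corresponding interval since the coset \<open>c + N\<Lambda>\<close> is dense. Comparing two roots is a sign condition on a form with
  coefficients of size at most \<open>2N\<^sup>2\<close>, whence the first factor of the modulus.
\<close>

lemma same_type_extend:
  assumes "finite I" "n \<in> I" "\<alpha> \<notin> \<rat>" "N > 0"
    and st: "same_type I \<alpha> (2 * N\<^sup>2 * fact (nat N)) u v"
  shows "\<exists>d. same_type I \<alpha> N (u(n := c)) (v(n := d))"
proof -
  define M where "M = 2 * N\<^sup>2 * fact (nat N)"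
  define J where "J = I - {n}"
  define A where "A w a = (\<Sum>i\<in>J. of_int (a i) * w i)" for w :: "'a \<Rightarrow> real" and a :: "'a \<Rightarrow> int"
  define small where "small a \<longleftrightarrow> (\<forall>i\<in>I. \<bar>a i\<bar> \<le> N)" for a :: "'a \<Rightarrow> int"
  have fact1: "fact (nat N) \<ge> (1::int)" by (simp add: fact_ge_1)
  have M_ge: "2 * N\<^sup>2 \<le> M"
    using mult_left_mono[OF fact1, of "2 * N\<^sup>2"] unfolding M_def by simp
  have M0: "M > 0" using \<open>N > 0\<close> M_def by simp
  have b_dvd: "b * N dvd M" if "0 < b" "b \<le> N" for b
  proof -
    have "nat b dvd fact (nat N)" using that by (intro dvd_fact) auto
    then have "int (nat b) dvd int (fact (nat N))" by (simp only: int_dvd_int_iff)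
    then have "b dvd fact (nat N)" using that by simp
    then have "b * N dvd fact (nat N) * (N * (2 * N))" by (intro mult_dvd_mono) auto
    then show ?thesis by (simp add: M_def power2_eq_square mult_ac)
  qed
  have N_dvd: "N dvd M" using b_dvd[of 1] \<open>N > 0\<close> by simp
  have split: "(\<Sum>i\<in>I. of_int (a i) * (w(n := x)) i) = of_int (a n) * x + A w a" for a w x
  proof -
    have "(\<Sum>i\<in>I. of_int (a i) * (w(n := x)) i)
        = of_int (a n) * x + (\<Sum>i\<in>J. of_int (a i) * (w(n := x)) i)"
      using assms(1,2) by (subst sum.remove[of I n]) (auto simp: J_def)
    also have "(\<Sum>i\<in>J. of_int (a i) * (w(n := x)) i) = A w a"
      unfolding A_def by (rule sum.cong) (auto simp: J_def)
    finally show ?thesis .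
  qed
  have sgnA: "sgn (A u a) = sgn (A v a)" if "\<And>i. i \<in> J \<Longrightarrow> \<bar>a i\<bar> \<le> M" for a
  proof -
    have "(\<Sum>i\<in>I. of_int ((a(n := 0)) i) * w i) = A w a" for w
      using split[of "a(n := 0)" w "w n"] by (simp add: A_def J_def)
    moreover have "\<bar>(a(n := 0)) i\<bar> \<le> M" if "i \<in> I" for i
      using that \<open>\<And>i. i \<in> J \<Longrightarrow> \<bar>a i\<bar> \<le> M\<close> M0 by (auto simp: J_def)
    ultimately show ?thesis
      using same_type_sgn[OF st[folded M_def], of "a(n := 0)"] by metis
  qed
  have comb: "A w (\<lambda>i. p * a i - q * a' i) = of_int p * A w a - of_int q * A w a'" for w p q a a'
    unfolding A_def by (simp add: sum_subtractf sum_distrib_left algebra_simps)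
  have sgn_comb: "sgn (of_int p * A u a - of_int q * A u a') = sgn (of_int p * A v a - of_int q * A v a')"
    if "small a" "small a'" "\<bar>p\<bar> \<le> N" "\<bar>q\<bar> \<le> N" for p q a a'
  proof -
    have "\<bar>p * a i - q * a' i\<bar> \<le> M" if "i \<in> J" for i
    proof -
      have "\<bar>p * a i\<bar> \<le> N * N" "\<bar>q * a' i\<bar> \<le> N * N"
        using that \<open>small a\<close> \<open>small a'\<close> \<open>\<bar>p\<bar> \<le> N\<close> \<open>\<bar>q\<bar> \<le> N\<close> \<open>N > 0\<close> unfolding abs_mult small_def J_def
        by (intro mult_mono; auto)+
      then show ?thesis using M_ge by (simp add: power2_eq_square)
    qed
    from sgnA[of "\<lambda>i. p * a i - q * a' i", OF this] show ?thesis unfolding comb .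
  qed
  \<comment> \<open>Forms in which the new coordinate has a positive coefficient suffice: the others are negated,
    or do not involve it.\<close>
  have reduce: ?thesis
    if g: "d - c \<in> grid \<alpha> N"
      and pos: "\<And>a. small a \<Longrightarrow> a n > 0 \<Longrightarrow>
        sgn (of_int (a n) * c + A u a) = sgn (of_int (a n) * d + A v a)" for d
  proof -
    have "sgn (of_int (a n) * c + A u a) = sgn (of_int (a n) * d + A v a)" if "small a" for a
    proof -
      consider "a n > 0" | "a n = 0" | "a n < 0" by linarith
      then show ?thesis
      proof cases
        case 1 with pos that show ?thesis by blast
      next
        case 2
        have "A w (\<lambda>i. 1 * a i - 0 * a i) = A w a" for w by simp
        then show ?thesis using 2 sgn_comb[of a a 1 0] that \<open>N > 0\<close> by simp
      next
        case 3
        have "small (\<lambda>i. - a i)" using that by (simp add: small_def)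
        moreover have "A w (\<lambda>i. - a i) = - A w a" for w by (simp add: A_def sum_negf)
        ultimately have "sgn (- (of_int (a n) * c + A u a)) = sgn (- (of_int (a n) * d + A v a))"
          using pos[of "\<lambda>i. - a i"] 3 by simp
        then show ?thesis by (simp only: sgn_minus neg_equal_iff_equal)
      qed
    qed
    moreover have "(v(n := d)) i - (u(n := c)) i \<in> grid \<alpha> N" if "i \<in> I" for i
      using g that st grid_mono[OF N_dvd, of \<alpha>] unfolding same_type_def M_def by auto
    ultimately have "same_type I \<alpha> N (u(n := c)) (v(n := d))"
      unfolding same_type_def split small_def by blast
    then show ?thesis by blast
  qed
  show ?thesis
  proof (cases "\<exists>a. small a \<and> a n > 0 \<and> of_int (a n) * c + A u a = 0")
    case True
    then obtain a where a: "small a" "a n > 0" and root: "of_int (a n) * c + A u a = 0" by blast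
    define b where "b = a n"
    have b: "b > 0" "b \<le> N" using a \<open>n \<in> I\<close> by (auto simp: b_def small_def)
    define d where "d = - A v a / of_int b"
    have bd: "of_int b * d = - A v a" using b by (simp add: d_def)
    have bc: "of_int b * c = - A u a" using root by (simp add: b_def)
    show ?thesis
    proof (rule reduce)
      have "A v a - A u a = (\<Sum>i\<in>J. of_int (a i) * (v i - u i))"
        by (simp add: A_def sum_subtractf algebra_simps)
      also have "\<dots> \<in> grid \<alpha> M"
        using st unfolding same_type_def M_def by (intro grid_sum grid_scale) (auto simp: J_def)
      also have "\<dots> \<subseteq> grid \<alpha> (b * N)" by (rule grid_mono[OF b_dvd[OF b]])
      finally obtain s t where "A v a - A u a = of_int (b * N) * (of_int s + of_int t * \<alpha>)"
        unfolding grid_def by auto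
      then have "of_int b * (d - c) = of_int b * (of_int N * (of_int (- s) + of_int (- t) * \<alpha>))"
        using bd bc by (simp add: algebra_simps)
      then have "d - c = of_int N * (of_int (- s) + of_int (- t) * \<alpha>)" using b by simp
      then show "d - c \<in> grid \<alpha> N" using gridI by metis
    next
      fix a' assume a': "small a'" "a' n > 0"
      define b' where "b' = a' n"
      have b': "\<bar>b'\<bar> \<le> N" "\<bar>b\<bar> \<le> N" using a' b \<open>n \<in> I\<close> by (auto simp: b'_def small_def)
      have "sgn (of_int b * (of_int b' * c + A u a')) = sgn (of_int b * A u a' - of_int b' * A u a)"
        by (rule arg_cong[of _ _ sgn]) (use bc in algebra)
      also have "\<dots> = sgn (of_int b * A v a' - of_int b' * A v a)"
        by (rule sgn_comb) fact+
      also have "\<dots> = sgn (of_int b * (of_int b' * d + A v a'))"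
        by (rule arg_cong[of _ _ sgn]) (use bd in algebra)
      finally show "sgn (of_int (a' n) * c + A u a') = sgn (of_int (a' n) * d + A v a')"
        using b by (simp add: sgn_mult b'_def)
    qed
  next
    case False
    \<comment> \<open>Extensional functions are used so that there are only finitely many of them.\<close>
    define F where "F = {a \<in> I \<rightarrow>\<^sub>E {-N..N}. a n > 0}"
    have finF: "finite F" unfolding F_def
      by (rule finite_subset[of _ "I \<rightarrow>\<^sub>E {-N..N}"]) (auto intro: finite_PiE \<open>finite I\<close>)
    define rt where "rt w a = - A w a / of_int (a n)" for w a
    define Lo where "Lo = rt v ` {a \<in> F. rt u a < c}"
    define Hi where "Hi = rt v ` {a \<in> F. c < rt u a}"
    have Fs: "small a" "a n > 0" if "a \<in> F" for a
      using that by (auto simp: F_def small_def dest!: PiE_mem)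
    have "\<exists>l h. l < h \<and> (\<forall>a\<in>Lo. a \<le> l) \<and> (\<forall>b\<in>Hi. h \<le> b)"
    proof (rule finite_sets_separated)
      show "finite Lo" "finite Hi" using finF by (auto simp: Lo_def Hi_def)
      fix x y assume "x \<in> Lo" "y \<in> Hi"
      then obtain a a' where aa: "a \<in> F" "a' \<in> F" and xy: "x = rt v a" "y = rt v a'"
        and lt: "rt u a < rt u a'" by (force simp: Lo_def Hi_def)
      have n: "\<bar>a n\<bar> \<le> N" "\<bar>a' n\<bar> \<le> N" using Fs aa \<open>n \<in> I\<close> by (auto simp: small_def)
      have eq: "rt w a < rt w a' \<longleftrightarrow> sgn (of_int (a n) * A w a' - of_int (a' n) * A w a) = - 1" for w
      proof -
        have p: "of_int (a n) > (0::real)" "of_int (a' n) > (0::real)" using Fs(2) aa by auto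
        have "rt w a < rt w a' \<longleftrightarrow> of_int (a n) * A w a' - of_int (a' n) * A w a < 0"
          unfolding rt_def using p by (simp add: divide_less_eq less_divide_eq field_simps)
        then show ?thesis by (simp add: sgn_if)
      qed
      show "x < y" using lt unfolding xy eq
        using sgn_comb[of a' a "a n" "a' n"] Fs aa n by simp
    qed
    then obtain l h where lh: "l < h" "\<And>x. x \<in> Lo \<Longrightarrow> x \<le> l" "\<And>y. y \<in> Hi \<Longrightarrow> h \<le> y" by blast
    obtain g where g: "g \<in> grid \<alpha> N" "l < c + g" "c + g < h"
      using grid_dense[OF \<open>\<alpha> \<notin> \<rat>\<close> \<open>N > 0\<close> lh(1)] by blast
    show ?thesis
    proof (rule reduce)
      show "c + g - c \<in> grid \<alpha> N" using g by simp
      fix a assume a: "small a" "a n > 0"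
      define a' where "a' = restrict a I"
      have a'F: "a' \<in> F" using a \<open>n \<in> I\<close> by (fastforce simp: a'_def F_def small_def abs_le_iff)
      have Aa': "A w a' = A w a" "a' n = a n" for w
        using \<open>n \<in> I\<close> by (auto simp: A_def a'_def J_def intro!: sum.cong)
      have p: "of_int (a n) > (0::real)" using a by simp
      have eq: "of_int (a n) * x + A w a = of_int (a n) * (x - rt w a')" for w x
        using p by (simp add: rt_def Aa' field_simps)
      have "rt u a' \<noteq> c" using False a eq[of c u] by auto
      then consider "rt u a' < c" | "c < rt u a'" by linarith
      then have "sgn (c - rt u a') = sgn (c + g - rt v a')"
      proof cases
        case 1
        then have "rt v a' \<in> Lo" using a'F by (auto simp: Lo_def)
        then have "rt v a' < c + g" using lh(2) g(2) by force
        with 1 show ?thesis by simp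
      next
        case 2
        then have "rt v a' \<in> Hi" using a'F by (auto simp: Hi_def)
        then have "c + g < rt v a'" using lh(3) g(3) by force
        with 2 show ?thesis by simp
      qed
      then show "sgn (of_int (a n) * c + A u a) = sgn (of_int (a n) * (c + g) + A v a)"
        unfolding eq using p by (simp add: sgn_mult)
    qed
  qed
qed

section \<open>Truth of formulas is determined by approximate types\<close>

text \<open>
  The constant coordinate \<open>1\<close> at position \<open>K\<close> turns affine forms in the fractional parts into
  linear ones. In particular, sign conditions express that a coordinate lies in \<open>[0, 1)\<close>.
\<close>

definition coords :: "real \<Rightarrow> nat \<Rightarrow> (nat \<Rightarrow> int) \<Rightarrow> nat \<Rightarrow> real" where
  "coords \<alpha> K e i = (if i < K then frac (\<alpha> * of_int (e i)) else 1)"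

lemma coords_upd: "n < K \<Longrightarrow> coords \<alpha> K (e(n := x)) = (coords \<alpha> K e)(n := frac (\<alpha> * of_int x))"
  by (auto simp: coords_def)

lemma coords_sum:
  "(\<Sum>i\<le>K. of_int (a i) * coords \<alpha> K e i) = (\<Sum>i<K. of_int (a i) * frac (\<alpha> * of_int (e i))) + of_int (a K)"
  by (simp add: coords_def lessThan_Suc_atMost[symmetric])

lemma frac_linear:
  fixes a e :: "nat \<Rightarrow> int" and \<alpha> :: real
  shows "frac (\<alpha> * of_int (\<Sum>i<K. a i * e i)) = frac (\<Sum>i<K. of_int (a i) * frac (\<alpha> * of_int (e i)))"
proof (rule frac_cong)
  have "\<alpha> * of_int (\<Sum>i<K. a i * e i) - (\<Sum>i<K. of_int (a i) * frac (\<alpha> * of_int (e i)))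
     = of_int (\<Sum>i<K. a i * \<lfloor>\<alpha> * of_int (e i)\<rfloor>)"
    unfolding of_int_sum sum_distrib_left sum_subtractf[symmetric]
    by (intro sum.cong) (simp_all add: frac_def algebra_simps)
  then show "\<alpha> * of_int (\<Sum>i<K. a i * e i) - (\<Sum>i<K. of_int (a i) * frac (\<alpha> * of_int (e i))) \<in> \<int>"
    by (metis Ints_of_int)
qed

lemma sgn_eqD:
  fixes x y :: real
  assumes "sgn x = sgn y"
  shows "0 \<le> x \<longleftrightarrow> 0 \<le> y" and "x < 0 \<longleftrightarrow> y < 0"
  using assms by (auto simp: sgn_if split: if_splits)

lemma floor_same_type:
  fixes a :: "nat \<Rightarrow> int" and \<alpha> :: real and K :: nat
  defines "L \<equiv> \<lambda>e. \<Sum>i<K. of_int (a i) * frac (\<alpha> * of_int (e i))"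
  assumes st: "same_type {..K} \<alpha> N (coords \<alpha> K e) (coords \<alpha> K e')"
    and N: "(\<Sum>i<K. \<bar>a i\<bar>) < N"
  shows "\<lfloor>L e\<rfloor> = \<lfloor>L e'\<rfloor>" and "\<bar>\<lfloor>L e\<rfloor>\<bar> \<le> (\<Sum>i<K. \<bar>a i\<bar>)"
proof -
  define A where "A = (\<Sum>i<K. \<bar>a i\<bar>)"
  have a_le: "\<bar>a i\<bar> \<le> A" if "i < K" for i
    unfolding A_def using that by (intro member_le_sum) auto
  have "\<bar>L e\<bar> \<le> (\<Sum>i<K. \<bar>of_int (a i) * frac (\<alpha> * of_int (e i))\<bar>)" unfolding L_def by (rule sum_abs)
  also have "\<dots> \<le> (\<Sum>i<K. of_int \<bar>a i\<bar>)"
    by (intro sum_mono) (auto simp: abs_mult intro!: mult_left_le less_imp_le[OF frac_lt_1])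
  also have "\<dots> = of_int A" by (simp add: A_def)
  finally have "of_int (- A) \<le> L e" "L e \<le> of_int A" by auto
  then have m: "- A \<le> \<lfloor>L e\<rfloor>" "\<lfloor>L e\<rfloor> \<le> A" by (simp add: le_floor_iff, linarith)
  then show "\<bar>\<lfloor>L e\<rfloor>\<bar> \<le> (\<Sum>i<K. \<bar>a i\<bar>)" unfolding A_def by linarith
  have sgn: "sgn (L e - of_int m) = sgn (L e' - of_int m)" if "\<bar>m\<bar> \<le> N" for m
  proof -
    have "(\<Sum>i\<le>K. of_int ((a(K := - m)) i) * coords \<alpha> K e i) = L e - of_int m" for e
      unfolding coords_sum L_def by simp
    moreover have "\<bar>(a(K := - m)) i\<bar> \<le> N" if "i \<in> {..K}" for i
      using that a_le[of i] N \<open>\<bar>m\<bar> \<le> N\<close> by (auto simp: A_def)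
    ultimately show ?thesis using same_type_sgn[OF st, of "a(K := - m)"] by metis
  qed
  have s1: "sgn (L e - of_int \<lfloor>L e\<rfloor>) = sgn (L e' - of_int \<lfloor>L e\<rfloor>)"
    and s2: "sgn (L e - of_int (\<lfloor>L e\<rfloor> + 1)) = sgn (L e' - of_int (\<lfloor>L e\<rfloor> + 1))"
    using m N by (intro sgn; simp add: A_def)+
  have "L e - of_int \<lfloor>L e\<rfloor> \<ge> 0" "L e - of_int (\<lfloor>L e\<rfloor> + 1) < 0" by linarith+
  with sgn_eqD(1)[OF s1] sgn_eqD(2)[OF s2]
  have "L e' - of_int \<lfloor>L e\<rfloor> \<ge> 0" "L e' - of_int (\<lfloor>L e\<rfloor> + 1) < 0" by simp_all
  then show "\<lfloor>L e\<rfloor> = \<lfloor>L e'\<rfloor>" by (intro sym[OF floor_unique]) auto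
qed

text \<open>
  By \<open>frac_linear\<close>, \<open>{\<alpha>\<Sum>a\<^sub>ie\<^sub>i}\<close> is a linear form in the coordinates minus its integer part. That
  integer is bounded in terms of the coefficients, so approximate types determine it.
\<close>

lemma linear_compare_same_type:
  fixes a b :: "nat \<Rightarrow> int"
  shows "\<exists>N>0. \<forall>e e'. same_type {..K} \<alpha> N (coords \<alpha> K e) (coords \<alpha> K e') \<longrightarrow>
    (frac (\<alpha> * of_int (\<Sum>i<K. a i * e i)) < frac (\<alpha> * of_int (\<Sum>i<K. b i * e i)) \<longleftrightarrow>
     frac (\<alpha> * of_int (\<Sum>i<K. a i * e' i)) < frac (\<alpha> * of_int (\<Sum>i<K. b i * e' i)))"
proof -
  define A B N where "A = (\<Sum>i<K. \<bar>a i\<bar>)" and "B = (\<Sum>i<K. \<bar>b i\<bar>)" and "N = A + B + 1"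
  have AB: "A \<ge> 0" "B \<ge> 0" by (simp_all add: A_def B_def sum_nonneg)
  define L where "L a e = (\<Sum>i<K. of_int (a i) * frac (\<alpha> * of_int (e i)))" for a e :: "nat \<Rightarrow> int"
  have "frac (L a e) < frac (L b e) \<longleftrightarrow> frac (L a e') < frac (L b e')"
    if st: "same_type {..K} \<alpha> N (coords \<alpha> K e) (coords \<alpha> K e')" for e e'
  proof -
    define p q where "p = \<lfloor>L a e\<rfloor>" and "q = \<lfloor>L b e\<rfloor>"
    have p: "p = \<lfloor>L a e'\<rfloor>" "\<bar>p\<bar> \<le> A" and q: "q = \<lfloor>L b e'\<rfloor>" "\<bar>q\<bar> \<le> B"
      using floor_same_type[OF st, of a] floor_same_type[OF st, of b] AB
      by (auto simp: p_def q_def L_def N_def A_def B_def)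
    define c where "c = (\<lambda>i. b i - a i)(K := p - q)"
    have "(\<Sum>i\<le>K. of_int (c i) * coords \<alpha> K e i) = (L b e - of_int q) - (L a e - of_int p)" for e
      unfolding coords_sum c_def L_def by (simp add: sum_subtractf algebra_simps)
    moreover have "\<bar>c i\<bar> \<le> N" if "i \<in> {..K}" for i
    proof (cases "i = K")
      case False
      then have "i \<in> {..<K}" using that by simp
      then have "\<bar>a i\<bar> \<le> A" "\<bar>b i\<bar> \<le> B"
        unfolding A_def B_def by (rule member_le_sum; simp)+
      then show ?thesis using False by (simp add: c_def N_def)
    qed (use p q in \<open>simp add: c_def N_def\<close>)
    ultimately have "sgn ((L b e - of_int q) - (L a e - of_int p)) = sgn ((L b e' - of_int q) - (L a e' - of_int p))"
      using same_type_sgn[OF st, of c] by metis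
    then have "L a e - of_int p < L b e - of_int q \<longleftrightarrow> L a e' - of_int p < L b e' - of_int q"
      by (simp add: sgn_if split: if_splits)
    then show ?thesis unfolding frac_def p(1)[symmetric] q(1)[symmetric] p_def[symmetric] q_def[symmetric] .
  qed
  then show ?thesis unfolding frac_linear L_def
    by (intro exI[of _ N]) (use AB in \<open>auto simp: N_def\<close>)
qed

text \<open>
  The extension step produces a real number \<open>d\<close>. As \<open>d\<close> lies in \<open>[0, 1)\<close> and differs from some
  \<open>{\<alpha>x}\<close> by an element of \<open>\<Lambda>\<close>, it is again the fractional part of an integer multiple of \<open>\<alpha>\<close>.
\<close>

lemma coords_extend:
  assumes "\<alpha> \<notin> \<rat>" "N > 0" "n < K"
    and "same_type {..K} \<alpha> (2 * N\<^sup>2 * fact (nat N)) (coords \<alpha> K e) (coords \<alpha> K e')"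
  shows "\<exists>y. same_type {..K} \<alpha> N (coords \<alpha> K (e(n := x))) (coords \<alpha> K (e'(n := y)))"
proof -
  let ?u = "(coords \<alpha> K e)(n := frac (\<alpha> * of_int x))"
  obtain d where d: "same_type {..K} \<alpha> N ?u ((coords \<alpha> K e')(n := d))" (is "same_type _ _ _ _ ?v")
    using same_type_extend[OF finite_atMost _ assms(1,2,4), of n] \<open>n < K\<close> by auto
  have "d - frac (\<alpha> * of_int x) \<in> grid \<alpha> N"
    using d \<open>n < K\<close> unfolding same_type_def by (force dest: bspec[of _ _ n])
  then obtain s t where st: "d - frac (\<alpha> * of_int x) = of_int N * (of_int s + of_int t * \<alpha>)"
    unfolding grid_def by auto
  \<comment> \<open>The forms for \<open>z = 0\<close> and \<open>z = -1\<close> locate the new coordinate in \<open>[0, 1)\<close>.\<close>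
  have form: "(\<Sum>i\<le>K. of_int (if i = n then 1 else if i = K then z else 0) * w i) = w n + of_int z * w K"
    for w :: "nat \<Rightarrow> real" and z :: int
  proof -
    have "(\<Sum>i\<le>K. of_int (if i = n then 1 else if i = K then z else 0) * w i)
      = (\<Sum>i\<le>K. (if i = n then w i else 0) + (if i = K then of_int z * w i else 0))"
      by (rule sum.cong) (use \<open>n < K\<close> in auto)
    then show ?thesis using \<open>n < K\<close> by (simp add: sum.distrib)
  qed
  have sgn: "sgn (frac (\<alpha> * of_int x) + of_int z) = sgn (d + of_int z)" if "\<bar>z\<bar> \<le> 1" for z
    using same_type_sgn[OF d, of "\<lambda>i. if i = n then 1 else if i = K then z else 0"] that \<open>N > 0\<close> \<open>n < K\<close>
    unfolding form by (simp add: coords_def)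
  have "0 \<le> d" "d < 1"
    using sgn[of 0] sgn[of "-1"] frac_ge_0[of "\<alpha> * of_int x"] frac_lt_1[of "\<alpha> * of_int x"]
    by (auto simp: sgn_if split: if_splits)
  moreover have "\<alpha> * of_int (x + N * t) - d = of_int (\<lfloor>\<alpha> * of_int x\<rfloor> - N * s)"
    using st by (simp add: frac_def algebra_simps)
  ultimately have "frac (\<alpha> * of_int (x + N * t)) = d"
    unfolding frac_unique_iff by (metis Ints_of_int)
  then show ?thesis using d \<open>n < K\<close> by (intro exI[of _ "x + N * t"]) (simp only: coords_upd)
qed

text \<open>
  Induction on the formula: each quantifier costs one extension step, which is paid for by a larger
  \<open>N\<close>.
\<close>

lemma sat_same_type:
  assumes "\<alpha> \<notin> \<rat>"
  shows "wf_form (int_cyc_struct \<alpha>) \<phi> \<Longrightarrow> fvars \<phi> \<subseteq> {..<K} \<Longrightarrow>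
    \<exists>N>0. \<forall>e e'. same_type {..K} \<alpha> N (coords \<alpha> K e) (coords \<alpha> K e') \<longrightarrow>
      sat (int_cyc_struct \<alpha>) e \<phi> = sat (int_cyc_struct \<alpha>) e' \<phi>"
proof (induction \<phi>)
  case (Eq s t)
  obtain a b where ab: "\<And>e. eval_term (int_cyc_struct \<alpha>) e s = (\<Sum>i<K. a i * e i)"
    "\<And>e. eval_term (int_cyc_struct \<alpha>) e t = (\<Sum>i<K. b i * e i)"
    using term_linear[of \<alpha> s K] term_linear[of \<alpha> t K] Eq by auto
  obtain M where M: "M > 0" "\<And>e e'. same_type {..K} \<alpha> M (coords \<alpha> K e) (coords \<alpha> K e') \<Longrightarrow>
    (frac (\<alpha> * of_int (\<Sum>i<K. a i * e i)) < frac (\<alpha> * of_int (\<Sum>i<K. b i * e i)) \<longleftrightarrow>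
     frac (\<alpha> * of_int (\<Sum>i<K. a i * e' i)) < frac (\<alpha> * of_int (\<Sum>i<K. b i * e' i)))"
    using linear_compare_same_type[of K \<alpha> a b] by blast
  obtain N where N: "N > 0" "\<And>e e'. same_type {..K} \<alpha> N (coords \<alpha> K e) (coords \<alpha> K e') \<Longrightarrow>
    (frac (\<alpha> * of_int (\<Sum>i<K. b i * e i)) < frac (\<alpha> * of_int (\<Sum>i<K. a i * e i)) \<longleftrightarrow>
     frac (\<alpha> * of_int (\<Sum>i<K. b i * e' i)) < frac (\<alpha> * of_int (\<Sum>i<K. a i * e' i)))"
    using linear_compare_same_type[of K \<alpha> b a] by blast
  have eq: "j = k \<longleftrightarrow> \<not> frac (\<alpha> * of_int j) < frac (\<alpha> * of_int k) \<and>
    \<not> frac (\<alpha> * of_int k) < frac (\<alpha> * of_int j)" for j k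
    using frac_mult_inj[OF assms, of j k] by (auto simp: not_less)
  show ?case
  proof (intro exI[of _ "M * N"] conjI allI impI)
    show "M * N > 0" using M(1) N(1) by simp
    fix e e' assume st: "same_type {..K} \<alpha> (M * N) (coords \<alpha> K e) (coords \<alpha> K e')"
    have "same_type {..K} \<alpha> M (coords \<alpha> K e) (coords \<alpha> K e')" "same_type {..K} \<alpha> N (coords \<alpha> K e) (coords \<alpha> K e')"
      using M(1) N(1) by (auto intro: same_type_mono[OF st])
    from M(2)[OF this(1)] N(2)[OF this(2)]
    show "sat (int_cyc_struct \<alpha>) e (Eq s t) = sat (int_cyc_struct \<alpha>) e' (Eq s t)"
      unfolding sat.simps ab
      unfolding eq[of "\<Sum>i<K. a i * e i" "\<Sum>i<K. b i * e i"] eq[of "\<Sum>i<K. a i * e' i" "\<Sum>i<K. b i * e' i"]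
      by blast
  qed
next
  case (Rel r ts)
  then have "length ts = 3" by (simp add: int_cyc_struct_def)
  then obtain t1 t2 t3 where ts: "ts = [t1, t2, t3]"
    by (auto simp: numeral_3_eq_3 length_Suc_conv)
  obtain a b c where abc: "\<And>e. eval_term (int_cyc_struct \<alpha>) e t1 = (\<Sum>i<K. a i * e i)"
    "\<And>e. eval_term (int_cyc_struct \<alpha>) e t2 = (\<Sum>i<K. b i * e i)"
    "\<And>e. eval_term (int_cyc_struct \<alpha>) e t3 = (\<Sum>i<K. c i * e i)"
    using term_linear[of \<alpha> t1 K] term_linear[of \<alpha> t2 K] term_linear[of \<alpha> t3 K] Rel unfolding ts by auto
  define P where "P e e' a b \<longleftrightarrow>
    (frac (\<alpha> * of_int (\<Sum>i<K. a i * e i)) < frac (\<alpha> * of_int (\<Sum>i<K. b i * e i)) \<longleftrightarrow>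
     frac (\<alpha> * of_int (\<Sum>i<K. a i * e' i)) < frac (\<alpha> * of_int (\<Sum>i<K. b i * e' i)))"
    for e e' a b :: "nat \<Rightarrow> int"
  obtain N1 N2 N3 where pos: "N1 > 0" "N2 > 0" "N3 > 0"
    and N1: "\<And>e e'. same_type {..K} \<alpha> N1 (coords \<alpha> K e) (coords \<alpha> K e') \<Longrightarrow> P e e' a b"
    and N2: "\<And>e e'. same_type {..K} \<alpha> N2 (coords \<alpha> K e) (coords \<alpha> K e') \<Longrightarrow> P e e' b c"
    and N3: "\<And>e e'. same_type {..K} \<alpha> N3 (coords \<alpha> K e) (coords \<alpha> K e') \<Longrightarrow> P e e' c a"
    using linear_compare_same_type[of K \<alpha> a b] linear_compare_same_type[of K \<alpha> b c]
      linear_compare_same_type[of K \<alpha> c a] unfolding P_def[symmetric] by blast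
  show ?case
  proof (intro exI[of _ "N1 * N2 * N3"] conjI allI impI)
    show "N1 * N2 * N3 > 0" using pos by simp
    fix e e' assume st: "same_type {..K} \<alpha> (N1 * N2 * N3) (coords \<alpha> K e) (coords \<alpha> K e')"
    have "P e e' a b" "P e e' b c" "P e e' c a"
      using pos by (auto intro!: N1 N2 N3 same_type_mono[OF st])
    then show "sat (int_cyc_struct \<alpha>) e (Rel r ts) = sat (int_cyc_struct \<alpha>) e' (Rel r ts)"
      unfolding sat.simps ts list.map abc P_def
      by (simp only: int_cyc_struct_def fo_struct.simps nth_Cons_0 nth_Cons_Suc numeral_2_eq_2 One_nat_def cyc_ord_iff_frac)
  qed
next
  case (Neg \<phi>)
  then show ?case by auto
next
  case (Conj \<phi> \<psi>)
  then have "wf_form (int_cyc_struct \<alpha>) \<phi>" "wf_form (int_cyc_struct \<alpha>) \<psi>"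
    "fvars \<phi> \<subseteq> {..<K}" "fvars \<psi> \<subseteq> {..<K}" by simp_all
  then obtain M N where MN: "M > 0" "N > 0"
    and M: "\<And>e e'. same_type {..K} \<alpha> M (coords \<alpha> K e) (coords \<alpha> K e') \<Longrightarrow> sat (int_cyc_struct \<alpha>) e \<phi> = sat (int_cyc_struct \<alpha>) e' \<phi>"
    and N: "\<And>e e'. same_type {..K} \<alpha> N (coords \<alpha> K e) (coords \<alpha> K e') \<Longrightarrow> sat (int_cyc_struct \<alpha>) e \<psi> = sat (int_cyc_struct \<alpha>) e' \<psi>"
    using Conj.IH by meson
  have "same_type {..K} \<alpha> M u v \<and> same_type {..K} \<alpha> N u v" if "same_type {..K} \<alpha> (M * N) u v" for u v
    using MN by (auto intro: same_type_mono[OF that])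
  then have "sat (int_cyc_struct \<alpha>) e (Conj \<phi> \<psi>) = sat (int_cyc_struct \<alpha>) e' (Conj \<phi> \<psi>)"
    if "same_type {..K} \<alpha> (M * N) (coords \<alpha> K e) (coords \<alpha> K e')" for e e'
    using M[of e e'] N[of e e'] that by simp
  moreover have "M * N > 0" using MN by simp
  ultimately show ?case by (intro exI[of _ "M * N"]) simp
next
  case (Exi n \<phi>)
  then obtain N where N: "N > 0" and n: "n < K"
    and *: "\<And>e e'. same_type {..K} \<alpha> N (coords \<alpha> K e) (coords \<alpha> K e') \<Longrightarrow> sat (int_cyc_struct \<alpha>) e \<phi> = sat (int_cyc_struct \<alpha>) e' \<phi>"
    by auto
  let ?M = "2 * N\<^sup>2 * fact (nat N)"
  have transfer: "sat (int_cyc_struct \<alpha>) e' (Exi n \<phi>)"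
    if st: "same_type {..K} \<alpha> ?M (coords \<alpha> K e) (coords \<alpha> K e')"
      and sat: "sat (int_cyc_struct \<alpha>) e (Exi n \<phi>)" for e e'
  proof -
    obtain x where "sat (int_cyc_struct \<alpha>) (e(n := x)) \<phi>" using sat by auto
    moreover obtain y where "same_type {..K} \<alpha> N (coords \<alpha> K (e(n := x))) (coords \<alpha> K (e'(n := y)))"
      using coords_extend[OF assms N n st] by blast
    ultimately show ?thesis using * by auto
  qed
  have "?M > 0" using N by simp
  moreover have "sat (int_cyc_struct \<alpha>) e (Exi n \<phi>) = sat (int_cyc_struct \<alpha>) e' (Exi n \<phi>)"
    if st: "same_type {..K} \<alpha> ?M (coords \<alpha> K e) (coords \<alpha> K e')" for e e'
    using transfer[OF st] transfer[OF same_type_sym[OF st]] by blast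
  ultimately show ?case by blast
qed

section \<open>Unary definable sets\<close>

lemma sgn_affine_near_0:
  fixes A R :: real
  shows "\<exists>s. \<forall>\<^sub>F t in at_right 0. sgn (A * t + R) = s"
proof (cases "R = 0")
  case True
  have "\<forall>\<^sub>F t in at_right (0::real). sgn (A * t + R) = sgn A"
    unfolding eventually_at_right[OF zero_less_one]
    by (intro exI[of _ 1]) (simp add: True sgn_mult)
  then show ?thesis by blast
next
  case False
  define b where "b = \<bar>R\<bar> / (\<bar>A\<bar> + 1)"
  have "b > 0" using False by (simp add: b_def)
  have "sgn (A * t + R) = sgn R" if "0 < t" "t < b" for t
  proof -
    have "\<bar>A * t\<bar> \<le> (\<bar>A\<bar> + 1) * t" using that by (simp add: abs_mult mult_right_mono)
    also have "\<dots> < \<bar>R\<bar>" using that by (simp add: b_def field_simps)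
    finally show ?thesis by (auto simp: sgn_if abs_if split: if_splits)
  qed
  then have "\<forall>\<^sub>F t in at_right (0::real). sgn (A * t + R) = sgn R"
    unfolding eventually_at_right[OF zero_less_one] using \<open>b > 0\<close> by blast
  then show ?thesis by blast
qed

text \<open>
  When one coordinate is close enough to \<open>0\<close> on the right, each of the finitely many affine
  functions of it that an approximate type tests has a constant sign.
\<close>

lemma same_type_near_0:
  fixes I :: "'i set"
  assumes "finite I" "n \<in> I"
  shows "\<exists>\<epsilon>>0. \<forall>s t. 0 < s \<and> s < \<epsilon> \<and> 0 < t \<and> t < \<epsilon> \<and> t - s \<in> grid \<alpha> N \<longrightarrow>
    same_type I \<alpha> N (u(n := s)) (u(n := t))"
proof -
  define R where "R a = (\<Sum>i\<in>I - {n}. of_int (a i) * u i)" for a :: "'i \<Rightarrow> int"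
  have split: "(\<Sum>i\<in>I. of_int (a i) * (u(n := t)) i) = of_int (a n) * t + R a" for a t
    using assms unfolding R_def by (subst sum.remove[of I n]) (auto intro!: sum.cong)
  define F where "F = I \<rightarrow>\<^sub>E {-N..N}"
  have finF: "finite F" unfolding F_def by (intro finite_PiE \<open>finite I\<close>) simp
  have "\<forall>a. \<exists>s. \<forall>\<^sub>F t in at_right 0. sgn (of_int (a n) * t + R a) = s"
    by (intro allI sgn_affine_near_0)
  from choice[OF this] obtain g
    where g: "\<And>a. \<forall>\<^sub>F t in at_right 0. sgn (of_int (a n) * t + R a) = g a" by blast
  have "\<forall>\<^sub>F t in at_right 0. \<forall>a\<in>F. sgn (of_int (a n) * t + R a) = g a"
    using g by (intro eventually_ball_finite finF) blast
  then obtain \<epsilon> where "\<epsilon> > 0"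
    and \<epsilon>: "\<And>t a. 0 < t \<Longrightarrow> t < \<epsilon> \<Longrightarrow> a \<in> F \<Longrightarrow> sgn (of_int (a n) * t + R a) = g a"
    unfolding eventually_at_right[OF zero_less_one] by blast
  have "same_type I \<alpha> N (u(n := s)) (u(n := t))"
    if st: "0 < s" "s < \<epsilon>" "0 < t" "t < \<epsilon>" "t - s \<in> grid \<alpha> N" for s t
    unfolding same_type_def
  proof (intro conjI allI impI ballI)
    fix a :: "'i \<Rightarrow> int" assume a: "\<forall>i\<in>I. \<bar>a i\<bar> \<le> N"
    have "a i \<in> {-N..N}" if "i \<in> I" for i using bspec[OF a that] by simp linarith
    then have "restrict a I \<in> F" by (simp add: F_def restrict_PiE_iff)
    then have "sgn (\<Sum>i\<in>I. of_int (restrict a I i) * (u(n := s)) i) =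
      sgn (\<Sum>i\<in>I. of_int (restrict a I i) * (u(n := t)) i)"
      unfolding split using \<epsilon>[OF st(1,2)] \<epsilon>[OF st(3,4)] by metis
    then show "sgn (\<Sum>i\<in>I. of_int (a i) * (u(n := s)) i) = sgn (\<Sum>i\<in>I. of_int (a i) * (u(n := t)) i)"
      by simp
  qed (use st in \<open>simp add: grid_0\<close>)
  with \<open>\<epsilon> > 0\<close> show ?thesis by blast
qed

text \<open>
  Multiplication by \<open>N\<close> ensures the congruences modulo \<open>N\<Lambda>\<close>: for \<open>N{\<alpha>x} < 1\<close> one has
  \<open>{\<alpha>Nx} = N{\<alpha>x}\<close>, which lies in \<open>N\<Lambda>\<close>.
\<close>

lemma definable_constant_near_0:
  assumes "\<alpha> \<notin> \<rat>" and X: "definable (int_cyc_struct \<alpha>) 1 X"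
  shows "\<exists>N>0. \<exists>\<epsilon>>0. \<forall>x y. 0 < frac (\<alpha> * of_int x) \<and> frac (\<alpha> * of_int x) < \<epsilon> \<and>
    0 < frac (\<alpha> * of_int y) \<and> frac (\<alpha> * of_int y) < \<epsilon> \<longrightarrow> ([N * x] \<in> X \<longleftrightarrow> [N * y] \<in> X)"
proof -
  obtain \<phi> p where \<phi>: "wf_form (int_cyc_struct \<alpha>) \<phi>"
    and Xeq: "X = {xs. length xs = 1 \<and> sat (int_cyc_struct \<alpha>) (\<lambda>i. if i < 1 then xs ! i else p i) \<phi>}"
    using X unfolding definable_def by blast
  have "(\<lambda>i. if i < 1 then [x] ! i else p i) = p(0 := x)" for x by auto
  then have memX: "[x] \<in> X \<longleftrightarrow> sat (int_cyc_struct \<alpha>) (p(0 := x)) \<phi>" for x unfolding Xeq by simp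
  obtain K where K: "1 \<le> K" "fvars \<phi> \<subseteq> {..<K}" using vars_bounded by blast
  obtain N where "N > 0" and N: "\<And>e e'. same_type {..K} \<alpha> N (coords \<alpha> K e) (coords \<alpha> K e') \<Longrightarrow>
      sat (int_cyc_struct \<alpha>) e \<phi> = sat (int_cyc_struct \<alpha>) e' \<phi>"
    using sat_same_type[OF assms(1) \<phi> K(2)] by blast
  obtain \<epsilon> where "\<epsilon> > 0" and \<epsilon>: "\<And>s t. 0 < s \<Longrightarrow> s < \<epsilon> \<Longrightarrow> 0 < t \<Longrightarrow> t < \<epsilon> \<Longrightarrow> t - s \<in> grid \<alpha> N \<Longrightarrow>
      same_type {..K} \<alpha> N ((coords \<alpha> K p)(0 := s)) ((coords \<alpha> K p)(0 := t))"
    using same_type_near_0[of "{..K}" 0 \<alpha> N "coords \<alpha> K p"] by auto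
  \<comment> \<open>The bound \<open>1 / N\<close> keeps \<open>N{\<alpha>x}\<close> below \<open>1\<close>.\<close>
  define \<delta> where "\<delta> = min \<epsilon> 1 / of_int N"
  have "\<delta> > 0" using \<open>\<epsilon> > 0\<close> \<open>N > 0\<close> by (simp add: \<delta>_def)
  have N\<delta>: "of_int N * \<delta> = min \<epsilon> 1" using \<open>N > 0\<close> by (simp add: \<delta>_def)
  have frac_N: "frac (\<alpha> * of_int (N * x)) = of_int N * frac (\<alpha> * of_int x)"
    "of_int N * frac (\<alpha> * of_int x) < \<epsilon>"
    if "frac (\<alpha> * of_int x) < \<delta>" for x
  proof -
    have "of_int N * frac (\<alpha> * of_int x) < of_int N * \<delta>" using that \<open>N > 0\<close> by simp
    then have lt: "of_int N * frac (\<alpha> * of_int x) < 1" "of_int N * frac (\<alpha> * of_int x) < \<epsilon>"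
      unfolding N\<delta> by simp_all
    have "\<alpha> * of_int (N * x) - of_int N * frac (\<alpha> * of_int x) = of_int (N * \<lfloor>\<alpha> * of_int x\<rfloor>)"
      by (simp add: frac_def algebra_simps)
    then show "frac (\<alpha> * of_int (N * x)) = of_int N * frac (\<alpha> * of_int x)"
      unfolding frac_unique_iff using lt \<open>N > 0\<close> by (metis Ints_of_int frac_ge_0 less_imp_le mult_nonneg_nonneg of_int_0_less_iff)
    show "of_int N * frac (\<alpha> * of_int x) < \<epsilon>" by (fact lt)
  qed
  have "[N * x] \<in> X \<longleftrightarrow> [N * y] \<in> X"
    if xy: "0 < frac (\<alpha> * of_int x)" "frac (\<alpha> * of_int x) < \<delta>" "0 < frac (\<alpha> * of_int y)" "frac (\<alpha> * of_int y) < \<delta>" for x y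
  proof -
    have "of_int N * frac (\<alpha> * of_int y) - of_int N * frac (\<alpha> * of_int x)
      = of_int N * (of_int (\<lfloor>\<alpha> * of_int x\<rfloor> - \<lfloor>\<alpha> * of_int y\<rfloor>) + of_int (y - x) * \<alpha>)"
      by (simp add: frac_def algebra_simps)
    then have "of_int N * frac (\<alpha> * of_int y) - of_int N * frac (\<alpha> * of_int x) \<in> grid \<alpha> N"
      using gridI by metis
    then have "same_type {..K} \<alpha> N (coords \<alpha> K (p(0 := N * x))) (coords \<alpha> K (p(0 := N * y)))"
      using K(1) xy \<open>N > 0\<close> frac_N[OF xy(2)] frac_N[OF xy(4)]
      by (simp only: coords_upd less_le_trans[OF zero_less_one] frac_N(1)) (rule \<epsilon>; simp)
    then show ?thesis unfolding memX by (rule N)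
  qed
  then show ?thesis using \<open>N > 0\<close> \<open>\<delta> > 0\<close> by blast
qed

section \<open>Independence over the rationals\<close>

lemma Kronecker_pair:
  fixes \<alpha> \<beta> x y \<epsilon> :: real
  assumes "\<alpha> \<notin> \<rat>" and "\<And>q r. q \<in> \<rat> \<Longrightarrow> r \<in> \<rat> \<Longrightarrow> \<beta> \<noteq> q * \<alpha> + r" and "\<epsilon> > 0"
  shows "\<exists>k m n. \<bar>of_int k * \<alpha> - of_int m - x\<bar> < \<epsilon> \<and> \<bar>of_int k * \<beta> - of_int n - y\<bar> < \<epsilon>"
proof -
  interpret Modules.module "\<lambda>r x. real_of_int r * x"
    by (rule Modules.module.intro) (simp_all add: distrib_left distrib_right)
  define \<theta> where "\<theta> i = (if i = 0 then \<alpha> else if i = 1 then \<beta> else 1)" for i :: nat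
  have ne: "\<alpha> \<noteq> 1" "\<beta> \<noteq> 1" "\<alpha> \<noteq> \<beta>"
  proof -
    show "\<alpha> \<noteq> 1" using assms(1) by (metis Rats_1)
    show "\<beta> \<noteq> 1" using assms(2)[of 0 1] by simp
    show "\<alpha> \<noteq> \<beta>" using assms(2)[of 1 0] by simp
  qed
  have im: "\<theta> ` {..2} = {\<alpha>, \<beta>, 1}"
  proof -
    have "{..2::nat} = {0, 1, 2}" by auto
    then show ?thesis by (auto simp: \<theta>_def)
  qed
  have "independent (\<theta> ` {..2})"
    unfolding im
  proof (subst dependent_finite)
    show "\<not> (\<exists>u. (\<exists>v\<in>{\<alpha>, \<beta>, 1}. u v \<noteq> 0) \<and> (\<Sum>v\<in>{\<alpha>, \<beta>, 1}. real_of_int (u v) * v) = 0)"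
    proof clarify
      fix u v assume v: "v \<in> {\<alpha>, \<beta>, 1}" "u v \<noteq> 0"
        and "(\<Sum>v\<in>{\<alpha>, \<beta>, 1}. real_of_int (u v) * v) = 0"
      then have eq: "of_int (u \<alpha>) * \<alpha> + of_int (u \<beta>) * \<beta> + of_int (u 1) = 0" using ne by simp
      have "u \<beta> = 0"
      proof (rule ccontr)
        assume "u \<beta> \<noteq> 0"
        then have "\<beta> = - of_int (u \<alpha>) / of_int (u \<beta>) * \<alpha> + - of_int (u 1) / of_int (u \<beta>)"
          using eq by (simp add: field_simps)
        moreover have "- of_int (u \<alpha>) / of_int (u \<beta>) \<in> \<rat>" "- of_int (u 1) / of_int (u \<beta>) \<in> \<rat>" by simp_all
        ultimately show False using assms(2) by blast
      qed
      moreover have "u \<alpha> = 0"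
      proof (rule ccontr)
        assume "u \<alpha> \<noteq> 0"
        then have "\<alpha> = - of_int (u 1) / of_int (u \<alpha>)" using eq \<open>u \<beta> = 0\<close> by (simp add: field_simps)
        also have "\<dots> \<in> \<rat>" by simp
        finally show False using assms(1) by simp
      qed
      ultimately show False using v eq by auto
    qed
  qed simp
  moreover have "inj_on \<theta> {..2}" using ne by (auto simp: inj_on_def \<theta>_def)
  moreover have "\<theta> 2 = 1" by (simp add: \<theta>_def)
  ultimately obtain k m where km: "\<And>i. i < 2 \<Longrightarrow>
      \<bar>of_int k * \<theta> i - of_int (m i) - (if i = 0 then x else y)\<bar> < \<epsilon>"
    using Kronecker_thm_2[of \<theta> 2 \<epsilon> "\<lambda>i. if i = 0 then x else y"] \<open>\<epsilon> > 0\<close> by blast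
  show ?thesis using km[of 0] km[of 1] by (auto simp: \<theta>_def)
qed

lemma frac_pair_in_box:
  fixes \<alpha> \<beta> :: real
  assumes "\<alpha> \<notin> \<rat>" and "\<And>q r. q \<in> \<rat> \<Longrightarrow> r \<in> \<rat> \<Longrightarrow> \<beta> \<noteq> q * \<alpha> + r"
    and "0 \<le> a" "a < b" "b \<le> 1" "0 \<le> c" "c < d" "d \<le> 1"
  shows "\<exists>k. frac (\<alpha> * of_int k) \<in> {a<..<b} \<and> frac (\<beta> * of_int k) \<in> {c<..<d}"
proof -
  define \<epsilon> where "\<epsilon> = min ((b - a) / 2) ((d - c) / 2)"
  have "\<epsilon> > 0" using assms by (simp add: \<epsilon>_def)
  obtain k m n where k: "\<bar>of_int k * \<alpha> - of_int m - (a + b) / 2\<bar> < \<epsilon>" "\<bar>of_int k * \<beta> - of_int n - (c + d) / 2\<bar> < \<epsilon>"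
    using Kronecker_pair[OF assms(1,2) \<open>\<epsilon> > 0\<close>, of "(a + b) / 2" "(c + d) / 2"] by blast
  have in_box: "frac (\<gamma> * of_int k) \<in> {l<..<h}"
    if "\<bar>of_int k * \<gamma> - of_int m - (l + h) / 2\<bar> < (h - l) / 2" "0 \<le> l" "h \<le> 1" for \<gamma> l h :: real and m
  proof -
    have lh: "l < of_int k * \<gamma> - of_int m" "of_int k * \<gamma> - of_int m < h"
      using that(1) unfolding abs_less_iff by argo+
    then have "frac (\<gamma> * of_int k) = of_int k * \<gamma> - of_int m"
      using that(2,3) by (subst frac_unique_iff) (auto simp: mult.commute)
    with lh show ?thesis by simp
  qed
  show ?thesis using in_box[of \<alpha> m a b] in_box[of \<beta> n c d] k assms by (auto simp: \<epsilon>_def)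
qed

lemma definable_cyc_interval:
  "definable (int_cyc_struct \<beta>) 1 {[x] | x. cyc_ord \<beta> 0 x 1}"
  unfolding definable_def
proof (intro exI conjI)
  let ?\<phi> = "Rel Cyc [Var 1, Var 0, Var 2]"
  show "wf_form (int_cyc_struct \<beta>) ?\<phi>" by (simp add: int_cyc_struct_def)
  show "{[x] | x. cyc_ord \<beta> 0 x 1} = {xs. length xs = 1 \<and>
    sat (int_cyc_struct \<beta>) (\<lambda>i. if i < 1 then xs ! i else (\<lambda>i. if i = 1 then 0 else 1) i) ?\<phi>}"
    by (auto simp: int_cyc_struct_def length_Suc_conv)
qed

text \<open>
  Independence of \<open>1, \<alpha>, \<beta>\<close> passes to \<open>1, \<alpha>, N\<beta>\<close>. Kronecker's theorem then yields \<open>x\<close> and \<open>y\<close> with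
  \<open>{\<alpha>x}\<close> and \<open>{\<alpha>y}\<close> arbitrarily small such that \<open>Nx\<close> lies in the \<open>\<beta>\<close>-interval from \<open>0\<close> to \<open>1\<close> and
  \<open>Ny\<close> does not.
\<close>

lemma is_reduct_imp_rationally_related:
  assumes \<alpha>: "\<alpha> \<notin> \<rat>" and \<beta>: "\<beta> \<notin> \<rat>"
    and red: "is_reduct (int_cyc_struct \<beta>) (int_cyc_struct \<alpha>)"
  shows "\<exists>q\<in>\<rat>. \<exists>r\<in>\<rat>. \<beta> = q * \<alpha> + r"
proof (rule ccontr)
  assume indep: "\<not> ?thesis"
  define X where "X = {[x] | x. cyc_ord \<beta> 0 x 1}"
  have "definable (int_cyc_struct \<alpha>) 1 X"
    using red definable_cyc_interval unfolding is_reduct_def X_def by blast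
  then obtain N \<epsilon> where "N > 0" "\<epsilon> > 0"
    and const: "\<And>x y. frac (\<alpha> * of_int x) \<in> {0<..<\<epsilon>} \<Longrightarrow> frac (\<alpha> * of_int y) \<in> {0<..<\<epsilon>} \<Longrightarrow>
      [N * x] \<in> X \<longleftrightarrow> [N * y] \<in> X"
    using definable_constant_near_0[OF \<alpha>] by auto blast
  have memX: "[x] \<in> X \<longleftrightarrow> 0 < frac (\<beta> * of_int x) \<and> frac (\<beta> * of_int x) < frac \<beta>" for x
    using frac_ge_0[of \<beta>] frac_ge_0[of "\<beta> * of_int x"]
    by (auto simp: X_def cyc_ord_iff_frac simp del: frac_ge_0)
  have indepN: "of_int N * \<beta> \<noteq> q * \<alpha> + r" if "q \<in> \<rat>" "r \<in> \<rat>" for q r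
  proof
    assume "of_int N * \<beta> = q * \<alpha> + r"
    then have "\<beta> = q / of_int N * \<alpha> + r / of_int N" using \<open>N > 0\<close> by (simp add: field_simps)
    moreover have "q / of_int N \<in> \<rat>" "r / of_int N \<in> \<rat>" using that by simp_all
    ultimately show False using indep by blast
  qed
  have fb: "0 < frac \<beta>" "frac \<beta> < 1" using \<beta> Ints_subset_Rats by (auto simp: frac_lt_1)
  obtain x where x: "frac (\<alpha> * of_int x) \<in> {0<..<min \<epsilon> 1}" "frac (of_int N * \<beta> * of_int x) \<in> {0<..<frac \<beta>}"
    using frac_pair_in_box[OF \<alpha> indepN, of 0 "min \<epsilon> 1" 0 "frac \<beta>"] fb \<open>\<epsilon> > 0\<close> by auto
  obtain y where y: "frac (\<alpha> * of_int y) \<in> {0<..<min \<epsilon> 1}" "frac (of_int N * \<beta> * of_int y) \<in> {frac \<beta><..<1}"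
    using frac_pair_in_box[OF \<alpha> indepN, of 0 "min \<epsilon> 1" "frac \<beta>" 1] fb \<open>\<epsilon> > 0\<close> by auto
  have "[N * x] \<in> X" "[N * y] \<notin> X" using x(2) y(2) by (simp_all add: memX mult_ac)
  moreover have "[N * x] \<in> X \<longleftrightarrow> [N * y] \<in> X" using x(1) y(1) by (intro const) auto
  ultimately show False by blast
qed

section \<open>Definable equivalence\<close>

theorem theorem3p12:
  fixes \<alpha> \<beta> :: real
  assumes "\<alpha> \<notin> \<rat>" and "\<beta> \<notin> \<rat>"
  shows "definably_equivalent (int_cyc_struct \<alpha>) (int_cyc_struct \<beta>) \<longleftrightarrow>
    (\<exists>q\<in>\<rat>. \<exists>r\<in>\<rat>. \<beta> = q * \<alpha> + r)"
proof
  assume "definably_equivalent (int_cyc_struct \<alpha>) (int_cyc_struct \<beta>)"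
  then show "\<exists>q\<in>\<rat>. \<exists>r\<in>\<rat>. \<beta> = q * \<alpha> + r"
    unfolding definably_equivalent_def using is_reduct_imp_rationally_related[OF assms] by blast
next
  assume "\<exists>q\<in>\<rat>. \<exists>r\<in>\<rat>. \<beta> = q * \<alpha> + r"
  then obtain q r where qr: "q \<in> \<rat>" "r \<in> \<rat>" "\<beta> = q * \<alpha> + r" by blast
  have "q \<noteq> 0" using assms(2) qr by auto
  then have "\<alpha> = (1 / q) * \<beta> + (- r / q)" using qr(3) by (simp add: field_simps)
  moreover have "1 / q \<in> \<rat>" "- r / q \<in> \<rat>" using qr by simp_all
  ultimately show "definably_equivalent (int_cyc_struct \<alpha>) (int_cyc_struct \<beta>)"
    unfolding definably_equivalent_def
    using rational_affine_clear_denominators[of \<beta> q \<alpha> r] qr is_reduct_rationally_related[OF assms(2)]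
      rational_affine_clear_denominators[of \<alpha> "1 / q" \<beta> "- r / q"] is_reduct_rationally_related[OF assms(1)]
    by blast
qed

end
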